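(* The set \[\oplus^{\rm fin} := \{ (v,s_1,s_2,s_3) : v\in R,\ s_1,s_2,s_3\in A^{\rm fin}_v,\ Z_v(s_1)+Z_v(s_2)=Z_v(s_3)\}\] is $\omega$-regular (i.e. the set of convolutions of its elements is recognized by a Büchi automaton over $\Sigma_\#^4$).
   Context: Let $\Sigma_\#=\{0,1,\#\}$. For $b=b_0b_1\cdots b_n\in\{0,1\}^*$ put $[b]_2=\sum_i b_i2^i$ (least significant digit first). Let $R\subseteq\Sigma_\#^\omega$ be the set of words of the form $(\#(0|1)^*1(0|1)^* )^\omega$; for $w=\#w_1\#w_2\#\cdots\in R$ let $\alpha(w)$ be the irrational number with continued fraction $[0;[w_1]_2,[w_2]_2,\dots]$. For irrational $\alpha=[0;a_1,a_2,\dots]$ let $q_{-1}=0,q_0=1,q_n=a_nq_{n-1}+q_{n-2}$. Every $X\in\mathbb{N}$ is uniquely $X=\sum_{n=0}^N b_{n+1}q_n$ with $0\le b_1<a_1$, $0\le b_{n+1}\le a_{n+1}$, and $b_n=0$ whenever $b_{n+1}=a_{n+1}$ (the $\alpha$-Ostrowski representation, unique up to trailing zeros). Two words in $\Sigma_\#^\omega$ are aligned if they have $\#$ at exactly the same positions. For $v\in R$, $A^{\rm fin}_v$ is the set of words $w=\#x_1\#x_2\#\cdots\in\Sigma_\#^\omega$ aligned with $v$ such that $[x_1]_2[x_2]_2\cdots$ (with all but finitely many entries $0$) is an $\alpha(v)$-Ostrowski representation of some $N\in\mathbb{N}$; then $Z_v(w):=N$. A set of tuples of infinite words is $\omega$-regular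 if the set of their convolutions (letterwise tuples) is accepted by a Büchi automaton. *)

theory Defs
  imports Complex_Main "HOL-Library.Omega_Words_Fun"
begin

subsection \<open>Buechi automata and \<open>\<omega>\<close>-regular languages\<close>

text \<open>The alphabet is the (finite) type of letters.\<close>

record ('q, 'a) buchi =
  states :: "'q set"
  initial :: "'q set"
  transitions :: "('q \<times> 'a \<times> 'q) set"
  accepting :: "'q set"

definition buchi_automaton :: "('q, 'a) buchi \<Rightarrow> bool" where
  "buchi_automaton A \<longleftrightarrow>
     finite (states A) \<and> initial A \<subseteq> states A \<and>
     transitions A \<subseteq> states A \<times> UNIV \<times> states A \<and> accepting A \<subseteq> states A"

definition buchi_run :: "('q, 'a) buchi \<Rightarrow> 'a word \<Rightarrow> 'q word \<Rightarrow> bool" where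
  "buchi_run A w r \<longleftrightarrow> r 0 \<in> initial A \<and> (\<forall>i. (r i, w i, r (Suc i)) \<in> transitions A)"

definition buchi_language :: "('q, 'a) buchi \<Rightarrow> 'a word set" where
  "buchi_language A = {w. \<exists>r. buchi_run A w r \<and> (\<exists>\<^sub>\<infinity>i. r i \<in> accepting A)}"

text \<open>
  States are taken from \<^typ>\<open>nat\<close> because one cannot quantify over types; as state sets are
  finite, this is no restriction (see \<open>omega_regularI\<close> below).
\<close>

definition omega_regular :: "'a::finite word set \<Rightarrow> bool" where
  "omega_regular L \<longleftrightarrow> (\<exists>A :: (nat, 'a) buchi. buchi_automaton A \<and> buchi_language A = L)"

lemma omega_regularI:
  fixes A :: "('q, 'a::finite) buchi"
  assumes A: "buchi_automaton A"
  shows "omega_regular (buchi_language A)"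
proof -
  have fin: "finite (states A)" and ini: "initial A \<subseteq> states A"
    and tr: "transitions A \<subseteq> states A \<times> UNIV \<times> states A" and acc: "accepting A \<subseteq> states A"
    using A by (auto simp: buchi_automaton_def)
  obtain f :: "'q \<Rightarrow> nat" where f: "inj_on f (states A)"
    using finite_imp_inj_to_nat_seg[OF fin] by blast
  define B where "B = \<lparr>states = f ` states A, initial = f ` initial A,
    transitions = (\<lambda>(p, a, q). (f p, a, f q)) ` transitions A, accepting = f ` accepting A\<rparr>"
  have B: "buchi_automaton B"
  proof -
    have "transitions B \<subseteq> states B \<times> UNIV \<times> states B"
    proof
      fix t assume "t \<in> transitions B"
      then obtain p a q where t: "(p, a, q) \<in> transitions A" "t = (f p, a, f q)"
        by (auto simp: B_def)
      moreover have "p \<in> states A" "q \<in> states A"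
        using tr t(1) by blast+
      ultimately show "t \<in> states B \<times> UNIV \<times> states B"
        by (simp add: B_def)
    qed
    moreover have "finite (states B)" "initial B \<subseteq> states B" "accepting B \<subseteq> states B"
      using fin image_mono[OF ini, of f] image_mono[OF acc, of f] by (simp_all add: B_def)
    ultimately show ?thesis
      unfolding buchi_automaton_def by blast
  qed
  have "buchi_language A \<subseteq> buchi_language B"
  proof
    fix w assume "w \<in> buchi_language A"
    then obtain r where r: "buchi_run A w r" "\<exists>\<^sub>\<infinity>i. r i \<in> accepting A"
      by (auto simp: buchi_language_def)
    have "buchi_run B w (f \<circ> r)"
    proof -
      have "((f \<circ> r) i, w i, (f \<circ> r) (Suc i)) \<in> transitions B" for i
      proof -
        have "(r i, w i, r (Suc i)) \<in> transitions A"
          using r(1) unfolding buchi_run_def by blast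
        then have "(\<lambda>(p, a, q). (f p, a, f q)) (r i, w i, r (Suc i)) \<in> transitions B"
          unfolding B_def buchi.simps by (rule imageI)
        then show ?thesis by simp
      qed
      moreover have "(f \<circ> r) 0 \<in> initial B"
        using r(1) by (simp add: buchi_run_def B_def)
      ultimately show ?thesis
        unfolding buchi_run_def by blast
    qed
    moreover have "\<exists>\<^sub>\<infinity>i. (f \<circ> r) i \<in> accepting B"
      using r(2) by (rule INFM_mono) (auto simp: B_def)
    ultimately show "w \<in> buchi_language B"
      by (auto simp: buchi_language_def)
  qed
  moreover have "buchi_language B \<subseteq> buchi_language A"
  proof
    fix w assume "w \<in> buchi_language B"
    then obtain r where r: "buchi_run B w r" "\<exists>\<^sub>\<infinity>i. r i \<in> accepting B"
      by (auto simp: buchi_language_def)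
    define g where "g = the_inv_into (states A) f"
    have g: "g (f q) = q" if "q \<in> states A" for q
      using the_inv_into_f_f[OF f that] by (simp add: g_def)
    have "g (r 0) \<in> initial A"
    proof -
      have "r 0 \<in> f ` initial A"
        using r(1) by (simp add: buchi_run_def B_def)
      then obtain q where "q \<in> initial A" "r 0 = f q"
        by blast
      moreover from this have "q \<in> states A"
        using ini by blast
      ultimately show ?thesis
        by (simp add: g)
    qed
    moreover have "(g (r i), w i, g (r (Suc i))) \<in> transitions A" for i
    proof -
      have "(r i, w i, r (Suc i)) \<in> transitions B"
        using r(1) by (simp add: buchi_run_def)
      then obtain p q where pq: "(p, w i, q) \<in> transitions A" "r i = f p" "r (Suc i) = f q"
        by (auto simp: B_def)
      moreover have "p \<in> states A" "q \<in> states A"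
        using tr pq(1) by blast+
      ultimately show ?thesis
        by (simp add: g)
    qed
    ultimately have "buchi_run A w (g \<circ> r)"
      by (simp add: buchi_run_def)
    moreover have "\<exists>\<^sub>\<infinity>i. (g \<circ> r) i \<in> accepting A"
      using r(2)
    proof (rule INFM_mono)
      fix i assume "r i \<in> accepting B"
      then obtain q where "q \<in> accepting A" "r i = f q"
        by (auto simp: B_def)
      moreover from this have "q \<in> states A"
        using acc by blast
      ultimately show "(g \<circ> r) i \<in> accepting A"
        by (simp add: g)
    qed
    ultimately show "w \<in> buchi_language A"
      by (auto simp: buchi_language_def)
  qed
  ultimately show ?thesis
    using B by (auto simp: omega_regular_def)
qed

definition convolution4 ::
    "'a word \<times> 'a word \<times> 'a word \<times> 'a word \<Rightarrow> ('a \<times> 'a \<times> 'a \<times> 'a) word" where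
  "convolution4 = (\<lambda>(u, v, w, x) i. (u i, v i, w i, x i))"


subsection \<open>Words over \<open>{0, 1, #}\<close>\<close>

datatype letter = Zero | One | Hash

instance letter :: finite
proof
  have "(UNIV :: letter set) = {Zero, One, Hash}"
    by (auto intro: letter.exhaust)
  then show "finite (UNIV :: letter set)"
    by (metis finite.emptyI finite.insertI)
qed

text \<open>The value of \<^const>\<open>Hash\<close> is irrelevant: it never occurs in a block.\<close>

definition bit_value :: "letter \<Rightarrow> nat" where
  "bit_value c = (if c = One then 1 else 0)"

definition bin_value :: "letter list \<Rightarrow> nat" where
  "bin_value b = (\<Sum>i<length b. bit_value (b ! i) * 2 ^ i)"

text \<open>Infinite concatenations of words from \<open>L\<close>; \<open>p n\<close> is the start of the \<open>n\<close>-th factor.\<close>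

definition omega_power :: "'a list set \<Rightarrow> 'a word set" where
  "omega_power L = {w. \<exists>p :: nat \<Rightarrow> nat. p 0 = 0 \<and> strict_mono p \<and>
     (\<forall>n. subsequence w (p n) (p (Suc n)) \<in> L)}"

definition R :: "letter word set" where
  "R = omega_power {Hash # x @ [One] @ y | x y. set x \<subseteq> {Zero, One} \<and> set y \<subseteq> {Zero, One}}"

definition hash_words :: "letter word set" where
  "hash_words = omega_power {Hash # x | x. set x \<subseteq> {Zero, One}}"

definition hash_positions :: "letter word \<Rightarrow> nat set" where
  "hash_positions w = {i. w i = Hash}"

definition aligned :: "letter word \<Rightarrow> letter word \<Rightarrow> bool" where
  "aligned v w \<longleftrightarrow> hash_positions v = hash_positions w"

text \<open>
  For \<open>w = # x\<^sub>1 # x\<^sub>2 # \<dots>\<close> and \<open>n \<ge> 1\<close>, \<open>block w n\<close> is \<open>x\<^sub>n\<close>. Note that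
  \<^const>\<open>enumerate\<close> counts the positions of \<open>#\<close> from \<open>0\<close>.
\<close>

definition block :: "letter word \<Rightarrow> nat \<Rightarrow> letter list" where
  "block w n = subsequence w (Suc (enumerate (hash_positions w) (n - 1)))
                             (enumerate (hash_positions w) n)"

definition block_value :: "letter word \<Rightarrow> nat \<Rightarrow> nat" where
  "block_value w n = bin_value (block w n)"


subsection \<open>Continued fractions and Ostrowski representations\<close>

primrec complete_quotient :: "real \<Rightarrow> nat \<Rightarrow> real" where
  "complete_quotient \<alpha> 0 = \<alpha>"
| "complete_quotient \<alpha> (Suc n) = 1 / frac (complete_quotient \<alpha> n)"

text \<open>\<open>\<alpha> = [partial_quotient \<alpha> 0; partial_quotient \<alpha> 1, \<dots>]\<close> for irrational \<open>\<alpha>\<close>.\<close>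

definition partial_quotient :: "real \<Rightarrow> nat \<Rightarrow> int" where
  "partial_quotient \<alpha> n = \<lfloor>complete_quotient \<alpha> n\<rfloor>"

text \<open>The second equation is the general recurrence at \<open>n = 1\<close> with \<open>q\<^sub>-\<^sub>1 = 0\<close>.\<close>

fun cf_denom :: "real \<Rightarrow> nat \<Rightarrow> int" where
  "cf_denom \<alpha> 0 = 1"
| "cf_denom \<alpha> (Suc 0) = partial_quotient \<alpha> 1 * cf_denom \<alpha> 0 + 0"
| "cf_denom \<alpha> (Suc (Suc n)) =
     partial_quotient \<alpha> (Suc (Suc n)) * cf_denom \<alpha> (Suc n) + cf_denom \<alpha> n"

definition cf_number :: "letter word \<Rightarrow> real" where
  "cf_number w = (THE \<alpha>. \<alpha> \<notin> \<rat> \<and> partial_quotient \<alpha> 0 = 0 \<and>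
     (\<forall>n\<ge>1. partial_quotient \<alpha> n = int (block_value w n)))"

text \<open>
  \<open>ostrowski_rep \<alpha> b X\<close>: the digits \<open>b\<^sub>1 b\<^sub>2 \<dots>\<close>, padded by zeros, form the
  \<open>\<alpha>\<close>-Ostrowski representation of \<open>X\<close>. The value \<open>b 0\<close> is not used.
\<close>

definition ostrowski_rep :: "real \<Rightarrow> (nat \<Rightarrow> nat) \<Rightarrow> nat \<Rightarrow> bool" where
  "ostrowski_rep \<alpha> b X \<longleftrightarrow>
     int (b 1) < partial_quotient \<alpha> 1 \<and>
     (\<forall>n. int (b (n + 1)) \<le> partial_quotient \<alpha> (n + 1)) \<and>
     (\<forall>n\<ge>1. int (b (n + 1)) = partial_quotient \<alpha> (n + 1) \<longrightarrow> b n = 0) \<and>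
     (\<exists>N. (\<forall>n>N. b (n + 1) = 0) \<and> int X = (\<Sum>n=0..N. int (b (n + 1)) * cf_denom \<alpha> n))"

definition A_fin :: "letter word \<Rightarrow> letter word set" where
  "A_fin v = {w \<in> hash_words. aligned w v \<and>
     (\<exists>N. ostrowski_rep (cf_number v) (block_value w) N)}"

definition Z :: "letter word \<Rightarrow> letter word \<Rightarrow> nat" where
  "Z v w = (THE N. ostrowski_rep (cf_number v) (block_value w) N)"

definition oplus_fin :: "(letter word \<times> letter word \<times> letter word \<times> letter word) set" where
  "oplus_fin = {(v, s\<^sub>1, s\<^sub>2, s\<^sub>3). v \<in> R \<and> s\<^sub>1 \<in> A_fin v \<and> s\<^sub>2 \<in> A_fin v \<and> s\<^sub>3 \<in> A_fin v \<and>
     Z v s\<^sub>1 + Z v s\<^sub>2 = Z v s\<^sub>3}"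

end

theory Submission
  imports Defs
begin

text \<open>
  Put \<open>d\<^sub>n = x\<^sub>n + y\<^sub>n - z\<^sub>n\<close> for the digits of the three words, so that one has to test whether
  \<open>\<Sum>d\<^sub>n\<^sub>+\<^sub>1 q\<^sub>n = 0\<close>. Horner evaluation from the top writes the partial sum \<open>\<Sum>\<^sub>n\<^sub>\<ge>\<^sub>k d\<^sub>n\<^sub>+\<^sub>1 q\<^sub>n\<close> as
  \<open>A\<^sub>k q\<^sub>k + A\<^sub>k\<^sub>+\<^sub>1 q\<^sub>k\<^sub>-\<^sub>1\<close>, where \<open>A\<^sub>k = A\<^sub>k\<^sub>+\<^sub>1 a\<^sub>k\<^sub>+\<^sub>1 + A\<^sub>k\<^sub>+\<^sub>2 + d\<^sub>k\<^sub>+\<^sub>1\<close>; the whole sum is \<open>A\<^sub>0\<close>. If it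
  vanishes, the partial sum is minus the lower part and so lies between \<open>-2 q\<^sub>k\<close> and \<open>q\<^sub>k\<close>, since an
  Ostrowski representation truncated below \<open>q\<^sub>k\<close> is less than \<open>q\<^sub>k\<close>. This forces \<open>\<bar>A\<^sub>k\<bar> \<le> 8\<close> for all
  \<open>k\<close>, so an automaton can guess the carries \<open>A\<^sub>k\<close> and verify, inside each block, a linear equation
  with bounded coefficients between numbers written in binary.
\<close>

subsection \<open>Regular sets of blocks\<close>

text \<open>Regularity in the sense of Myhill and Nerode: there are finitely many left quotients.\<close>

definition regular_pred :: "('a list \<Rightarrow> bool) \<Rightarrow> bool" where
  "regular_pred P \<longleftrightarrow> finite (range (\<lambda>u v. P (u @ v)))"

text \<open>A left quotient by a word arises by removing one letter at a time, so a finite set that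
  contains \<open>P\<close> and is closed under one-letter quotients contains every quotient of
  \<open>P\<close>.\<close>

lemma regular_predI:
  assumes "finite Q" "P \<in> Q" and closed: "\<And>K a. K \<in> Q \<Longrightarrow> (\<lambda>v. K (a # v)) \<in> Q"
  shows "regular_pred P"
proof -
  have "(\<lambda>v. K (u @ v)) \<in> Q" if "K \<in> Q" for u K
    using that by (induction u arbitrary: K) (auto dest: closed)
  then have "range (\<lambda>u v. P (u @ v)) \<subseteq> Q"
    using assms(2) by blast
  then show ?thesis
    unfolding regular_pred_def using assms(1) by (rule finite_subset)
qed

section \<open>Closure properties of regular predicates\<close>

lemma regular_pred_const: "regular_pred (\<lambda>_. c)"
  by (rule regular_predI[of "{\<lambda>_. c}"]) auto

text \<open>Product construction: the quotient of the combination by a word is determined by the two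
  quotients by that word, which range over finite sets.\<close>

lemma regular_pred_binop:
  assumes "regular_pred P" "regular_pred Q"
  shows "regular_pred (\<lambda>b. f (P b) (Q b))"
proof -
  have "range (\<lambda>u v. f (P (u @ v)) (Q (u @ v))) \<subseteq>
      (\<lambda>(g, h) v. f (g v) (h v)) ` (range (\<lambda>u v. P (u @ v)) \<times> range (\<lambda>u v. Q (u @ v)))"
    by force
  then show ?thesis
    using assms unfolding regular_pred_def by (meson finite_SigmaI finite_imageI finite_subset)
qed

lemma regular_pred_imp: "regular_pred P \<Longrightarrow> regular_pred Q \<Longrightarrow> regular_pred (\<lambda>b. P b \<longrightarrow> Q b)"
  by (rule regular_pred_binop)

lemma regular_pred_conj: "regular_pred P \<Longrightarrow> regular_pred Q \<Longrightarrow> regular_pred (\<lambda>b. P b \<and> Q b)"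
  by (rule regular_pred_binop)

lemma regular_pred_disj: "regular_pred P \<Longrightarrow> regular_pred Q \<Longrightarrow> regular_pred (\<lambda>b. P b \<or> Q b)"
  by (rule regular_pred_binop)

lemma regular_pred_iff: "regular_pred P \<Longrightarrow> regular_pred Q \<Longrightarrow> regular_pred (\<lambda>b. P b \<longleftrightarrow> Q b)"
  by (rule regular_pred_binop)

lemma regular_pred_letters: "regular_pred (\<lambda>b. set b \<subseteq> G)"
proof (rule regular_predI[of "{\<lambda>b. set b \<subseteq> G, \<lambda>_. False}"])
  fix K :: "'a list \<Rightarrow> bool" and a
  assume "K \<in> {\<lambda>b. set b \<subseteq> G, \<lambda>_. False}"
  then show "(\<lambda>v. K (a # v)) \<in> {\<lambda>b. set b \<subseteq> G, \<lambda>_. False}"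
    by (cases "a \<in> G") auto
qed auto

text \<open>Serves for the \<open>#\<close> in front of each block. The only new quotients are the
  predicate itself and the constantly false one; the others are quotients of
  \<open>P\<close>.\<close>

lemma regular_pred_Cons:
  assumes "regular_pred P"
  shows "regular_pred (\<lambda>b. \<exists>b'. b = s # b' \<and> P b')"
proof (rule regular_predI)
  let ?Q = "insert (\<lambda>b. \<exists>b'. b = s # b' \<and> P b') (insert (\<lambda>_. False) (range (\<lambda>u v. P (u @ v))))"
  show "finite ?Q"
    using assms by (simp add: regular_pred_def)
  show "(\<lambda>b. \<exists>b'. b = s # b' \<and> P b') \<in> ?Q"
    by simp
  fix K a
  assume "K \<in> ?Q"
  then consider "K = (\<lambda>b. \<exists>b'. b = s # b' \<and> P b')" | "K = (\<lambda>_. False)"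
    | u where "K = (\<lambda>v. P (u @ v))"
    by blast
  then show "(\<lambda>v. K (a # v)) \<in> ?Q"
  proof cases
    case 1
    have "P = (\<lambda>v. P ([] @ v))" by simp
    then have "P \<in> range (\<lambda>u v. P (u @ v))" by (rule range_eqI)
    moreover have "(\<lambda>v. K (a # v)) = (if a = s then P else (\<lambda>_. False))"
      using 1 by auto
    ultimately show ?thesis
      by simp
  next
    case 2
    then show ?thesis by simp
  next
    case (3 u)
    then have "(\<lambda>v. K (a # v)) = (\<lambda>v. P ((u @ [a]) @ v))"
      by simp
    then show ?thesis
      by blast
  qed
qed

text \<open>Least significant digit first, with arbitrary integers \<open>g a\<close> as digits. A
  linear combination of numbers read in parallel becomes one weighted value, so a single integer
  bound is enough as a state.\<close>

primrec weight_value :: "('a \<Rightarrow> int) \<Rightarrow> 'a list \<Rightarrow> int" where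
  "weight_value g [] = 0"
| "weight_value g (a # b) = g a + 2 * weight_value g b"

lemma weight_value_add: "weight_value (\<lambda>l. f l + g l) b = weight_value f b + weight_value g b"
  by (induction b) auto

lemma weight_value_diff: "weight_value (\<lambda>l. f l - g l) b = weight_value f b - weight_value g b"
  by (induction b) auto

lemma weight_value_cmult: "weight_value (\<lambda>l. c * g l) b = c * weight_value g b"
  by (induction b) (auto simp: algebra_simps)

lemma weight_value_uminus: "weight_value (\<lambda>l. - g l) b = - weight_value g b"
  by (induction b) auto

text \<open>Reading a letter \<open>a\<close> turns the bound \<open>c\<close> into \<open>(c - g a) div 2\<close>, so the bounds that occur never
  exceed the larger of the initial bound and the weights.\<close>

lemma regular_pred_weight_le:
  fixes g :: "'a::finite \<Rightarrow> int"
  shows "regular_pred (\<lambda>b. weight_value g b \<le> c)"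
proof -
  define B where "B = Max (insert \<bar>c\<bar> (range (\<lambda>a. \<bar>g a\<bar>)))"
  have c: "\<bar>c\<bar> \<le> B" and g: "\<bar>g a\<bar> \<le> B" for a
    unfolding B_def by (rule Max_ge; simp)+
  show ?thesis
  proof (rule regular_predI)
    let ?Q = "(\<lambda>c b. weight_value g b \<le> c) ` {-B..B}"
    show "finite ?Q" by simp
    show "(\<lambda>b. weight_value g b \<le> c) \<in> ?Q"
      using c by (intro imageI) auto
    fix K a
    assume "K \<in> ?Q"
    then obtain d where "d \<in> {-B..B}" and K: "K = (\<lambda>b. weight_value g b \<le> d)"
      by (rule imageE)
    then have d: "\<bar>d\<bar> \<le> B"
      by (simp add: abs_le_iff minus_le_iff)
    \<comment> \<open>Rounding down loses nothing, since the weighted value of the remaining word is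
      an integer.\<close>
    have "(\<lambda>v. K (a # v)) = (\<lambda>b. weight_value g b \<le> (d - g a) div 2)"
      unfolding K by (rule ext) auto
    moreover have "(d - g a) div 2 \<in> {-B..B}"
      using d g[of a] by auto
    ultimately show "(\<lambda>v. K (a # v)) \<in> ?Q"
      by (rule image_eqI)
  qed
qed

lemma regular_pred_weight_eq:
  fixes g :: "'a::finite \<Rightarrow> int"
  shows "regular_pred (\<lambda>b. weight_value g b = c)"
proof -
  have "regular_pred (\<lambda>b. weight_value g b \<le> c \<and> weight_value (\<lambda>l. - g l) b \<le> - c)"
    by (intro regular_pred_conj regular_pred_weight_le)
  then show ?thesis
    by (simp add: weight_value_uminus eq_iff)
qed

lemma regular_pred_weight_less:
  fixes f g :: "'a::finite \<Rightarrow> int"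
  shows "regular_pred (\<lambda>b. weight_value f b < weight_value g b)"
proof -
  have "weight_value f b < weight_value g b \<longleftrightarrow> weight_value (\<lambda>l. f l - g l) b \<le> -1" for b
    by (auto simp: weight_value_diff)
  then show ?thesis
    using regular_pred_weight_le by simp
qed

text \<open>The automaton guesses the labels \<open>p n\<close> at the ends of the factors; inside a factor its state is
  the left quotient that the rest of the factor has to satisfy.\<close>

lemma omega_regular_factorization:
  fixes E :: "'p \<Rightarrow> 'p \<Rightarrow> 'a::finite list \<Rightarrow> bool"
  assumes P: "finite P"
    and E: "\<And>p p'. p \<in> P \<Longrightarrow> p' \<in> P \<Longrightarrow> regular_pred (E p p')"
  shows "omega_regular {w. \<exists>h p. h 0 = 0 \<and> strict_mono h \<and> range p \<subseteq> P \<and> p 0 \<in> I \<and>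
    (\<forall>n. E (p n) (p (Suc n)) (subsequence w (h n) (h (Suc n)))) \<and> (\<exists>\<^sub>\<infinity>n. p n \<in> F)}"
    (is "omega_regular ?L")
proof -
  \<comment> \<open>A state holds the guessed labels \<open>p\<close> and \<open>p'\<close> at the
    two ends of the current factor, the quotient \<open>K\<close> that the unread part of the factor
    must satisfy, and a flag marking the first position of a factor.\<close>
  define S where "S = (SIGMA p:P. SIGMA p':P. range (\<lambda>u v. E p p' (u @ v)) \<times> (UNIV :: bool set))"
  \<comment> \<open>Either the factor continues, or \<open>a\<close> is its last letter, tested by
    \<open>K [a]\<close>. The closing transition consumes a letter, so factors are nonempty.\<close>
  define T where "T = {((p, p', K, b), a, (p2, p2', K2, b2)).
    (p2 = p \<and> p2' = p' \<and> K2 = (\<lambda>v. K (a # v)) \<and> \<not> b2) \<or>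
    (K [a] \<and> p2 = p' \<and> K2 = E p2 p2' \<and> b2)} \<inter> S \<times> UNIV \<times> S"
  \<comment> \<open>The flag in the accepting condition rejects runs that stay inside one factor for
    ever.\<close>
  define A where "A = \<lparr>states = S, initial = {(p, p', K, b) \<in> S. p \<in> I \<and> K = E p p' \<and> b},
    transitions = T, accepting = {(p, p', K, b) \<in> S. p \<in> F \<and> b}\<rparr>"
  have "finite S"
    unfolding S_def using P E by (intro finite_SigmaI) (auto simp: regular_pred_def)
  then have "buchi_automaton A"
    by (auto simp: A_def buchi_automaton_def T_def)
  then have "omega_regular (buchi_language A)"
    by (rule omega_regularI)
  moreover have "buchi_language A = ?L"
  proof (rule equalityI[rotated]; rule subsetI)
    fix w
    assume "w \<in> ?L"
    then obtain h :: "nat \<Rightarrow> nat" and p where h: "h 0 = 0" "strict_mono h"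
      and p: "range p \<subseteq> P" "p 0 \<in> I" "\<exists>\<^sub>\<infinity>n. p n \<in> F"
      and fac: "\<And>n. E (p n) (p (Suc n)) (subsequence w (h n) (h (Suc n)))"
      by blast
    \<comment> \<open>The number of the factor that contains position \<open>i\<close>.\<close>
    define idx where "idx i = (LEAST n. i < h (Suc n))" for i
    have ub: "i < h (Suc (idx i))" for i
    proof -
      have "i < h (Suc i)"
        using strict_mono_imp_increasing[OF h(2), of "Suc i"] by linarith
      then show ?thesis
        unfolding idx_def by (rule LeastI)
    qed
    have lb: "h (idx i) \<le> i" for i
    proof (cases "idx i")
      case 0
      then show ?thesis using h(1) by simp
    next
      case (Suc m)
      then have "\<not> i < h (Suc m)"
        using not_less_Least[of m "\<lambda>n. i < h (Suc n)"] by (simp add: idx_def)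
      then show ?thesis using Suc by simp
    qed
    have idx_eq: "idx i = n" if "h n \<le> i" "i < h (Suc n)" for i n
    proof -
      have "h n < h (Suc (idx i))" "h (idx i) < h (Suc n)"
        using ub[of i] lb[of i] that by linarith+
      then show ?thesis
        by (simp add: strict_mono_less[OF h(2)])
    qed
    define r where "r i = (p (idx i), p (Suc (idx i)),
      (\<lambda>v. E (p (idx i)) (p (Suc (idx i))) (subsequence w (h (idx i)) i @ v)), i = h (idx i))" for i
    have rS: "r i \<in> S" for i
      using p(1) by (auto simp: r_def S_def)
    have idx_h: "idx (h n) = n" for n
      by (rule idx_eq) (use h(2) in \<open>auto simp: strict_mono_Suc_iff\<close>)
    have tr: "(r i, w i, r (Suc i)) \<in> T" for i
    proof (cases "Suc i < h (Suc (idx i))")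
      case True
      then have "idx (Suc i) = idx i"
        using lb[of i] by (intro idx_eq) auto
      moreover have "subsequence w (h (idx i)) (Suc i) = subsequence w (h (idx i)) i @ [w i]"
        using lb[of i] by (simp add: subsequence_def)
      ultimately show ?thesis
        using rS[of i] rS[of "Suc i"] lb[of i] by (simp add: T_def r_def)
    next
      case False
      then have eq: "Suc i = h (Suc (idx i))"
        using ub[of i] by linarith
      have "subsequence w (h (idx i)) (Suc i) = subsequence w (h (idx i)) i @ [w i]"
        using lb[of i] by (simp add: subsequence_def)
      then have "E (p (idx i)) (p (Suc (idx i))) (subsequence w (h (idx i)) i @ [w i])"
        using fac[of "idx i"] eq by simp
      moreover have "idx (Suc i) = Suc (idx i)"
        using eq idx_h by simp
      ultimately show ?thesis
        using rS[of i] rS[of "Suc i"] eq by (simp add: T_def r_def)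
    qed
    have "idx 0 = 0"
      using idx_h[of 0] h(1) by simp
    then have "r 0 \<in> initial A"
      using rS[of 0] p(2) h(1) by (simp add: A_def r_def)
    then have "buchi_run A w r"
      using tr by (simp add: buchi_run_def A_def)
    moreover have "\<exists>\<^sub>\<infinity>i. r i \<in> accepting A"
      unfolding INFM_nat
    proof
      fix m
      obtain n where n: "n > m" "p n \<in> F"
        using p(3) unfolding INFM_nat by blast
      have "h n \<ge> n"
        using strict_mono_imp_increasing[OF h(2)] .
      moreover have "r (h n) \<in> accepting A"
        using n(2) rS[of "h n"] by (simp add: A_def r_def idx_h)
      ultimately show "\<exists>n>m. r n \<in> accepting A"
        using n(1) by (meson less_le_trans)
    qed
    ultimately show "w \<in> buchi_language A"
      by (auto simp: buchi_language_def)
  next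
    fix w
    assume "w \<in> buchi_language A"
    then obtain r where run: "buchi_run A w r" and acc: "\<exists>\<^sub>\<infinity>i. r i \<in> accepting A"
      by (auto simp: buchi_language_def)
    have r0: "r 0 \<in> initial A" and tr: "\<And>i. (r i, w i, r (Suc i)) \<in> T"
      using run by (auto simp: buchi_run_def A_def)
    define p1 where "p1 i = fst (r i)" for i
    define p2 where "p2 i = fst (snd (r i))" for i
    define K where "K i = fst (snd (snd (r i)))" for i
    define new where "new i = snd (snd (snd (r i)))" for i
    have rS: "r i \<in> S" for i
      using tr[of i] by (auto simp: T_def)
    have new0: "new 0" "p1 0 \<in> I" "K 0 = E (p1 0) (p2 0)"
      using r0 by (auto simp: A_def p1_def p2_def K_def new_def)
    have stay: "p1 (Suc i) = p1 i \<and> p2 (Suc i) = p2 i \<and> K (Suc i) = (\<lambda>v. K i (w i # v))"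
      if "\<not> new (Suc i)" for i
      using tr[of i] that by (auto simp: T_def p1_def p2_def K_def new_def)
    have move: "K i [w i] \<and> p1 (Suc i) = p2 i \<and> K (Suc i) = E (p1 (Suc i)) (p2 (Suc i))"
      if "new (Suc i)" for i
      using tr[of i] that by (auto simp: T_def p1_def p2_def K_def new_def)
    have newK: "K i = E (p1 i) (p2 i)" if "new i" for i
      using that new0 move by (cases i) auto
    \<comment> \<open>The cut points are read off from the flags; the acceptance condition makes
      them infinitely many.\<close>
    define N where "N = {i. new i}"
    have acc': "\<exists>\<^sub>\<infinity>i. p1 i \<in> F \<and> new i"
      using acc by (rule INFM_mono) (auto simp: A_def p1_def new_def)
    then have "infinite N"
      unfolding N_def INFM_iff_infinite[symmetric] by (rule INFM_mono) simp
    define h where "h = enumerate N"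
    have mono: "strict_mono h"
      unfolding h_def using \<open>infinite N\<close> by (rule strict_mono_enumerate)
    have rng: "range h = N"
      unfolding h_def using \<open>infinite N\<close> by (rule range_enumerate)
    have newh: "new (h n)" for n
      using rng by (auto simp: N_def)
    have h0: "h 0 = 0"
      unfolding h_def enumerate_0 by (rule Least_equality) (use new0 in \<open>auto simp: N_def\<close>)
    have gap: "\<not> new i" if "h n < i" "i < h (Suc n)" for i n
    proof
      assume "new i"
      then obtain m where "i = h m"
        using rng by (auto simp: N_def)
      then show False
        using that by (simp add: strict_mono_less[OF mono])
    qed
    have inv: "p1 i = p1 (h n) \<and> p2 i = p2 (h n) \<and>
        K i = (\<lambda>v. E (p1 (h n)) (p2 (h n)) (subsequence w (h n) i @ v))"
      if "h n \<le> i" "i < h (Suc n)" for i n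
      using that
    proof (induction i rule: dec_induct)
      case base
      then show ?case
        using newK[OF newh[of n]] by simp
    next
      case (step i)
      then have "\<not> new (Suc i)"
        using gap[of n "Suc i"] by simp
      then show ?case
        using stay step by (simp add: subsequence_def)
    qed
    have link: "p1 (h (Suc n)) = p2 (h n) \<and> E (p1 (h n)) (p2 (h n)) (subsequence w (h n) (h (Suc n)))"
      for n
    proof -
      have lt: "h n < h (Suc n)"
        using mono by (simp add: strict_mono_Suc_iff)
      then obtain i where i: "h (Suc n) = Suc i"
        by (cases "h (Suc n)") auto
      have "K i [w i] \<and> p1 (Suc i) = p2 i"
        using move[of i] newh[of "Suc n"] i by simp
      then show ?thesis
        using inv[of n i] i lt by (simp add: subsequence_def)
    qed
    have "p1 i \<in> P" for i
      using rS[of i] by (cases "r i") (simp add: S_def p1_def)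
    then have "range (\<lambda>n. p1 (h n)) \<subseteq> P"
      by blast
    moreover have "p1 (h 0) \<in> I"
      using new0 h0 by simp
    moreover have "\<exists>\<^sub>\<infinity>n. p1 (h n) \<in> F"
      unfolding INFM_nat
    proof
      fix m
      obtain i where i: "i > h m" "p1 i \<in> F" "new i"
        using acc' unfolding INFM_nat by blast
      then obtain n where "i = h n"
        using rng by (auto simp: N_def)
      then show "\<exists>n>m. p1 (h n) \<in> F"
        using i by (auto simp: strict_mono_less[OF mono])
    qed
    moreover have "\<forall>n. E (p1 (h n)) (p1 (h (Suc n))) (subsequence w (h n) (h (Suc n)))"
      using link by simp
    ultimately show "w \<in> ?L"
      using h0 mono by (intro CollectI exI[of _ h] exI[of _ "\<lambda>n. p1 (h n)"]) blast
  qed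
  ultimately show ?thesis
    by simp
qed

subsection \<open>Continued fractions with prescribed partial quotients\<close>

text \<open>A single step need not contract by a uniform factor, but after two steps the difference
  is divided by the product of \<open>a * (b + u) + 1\<close> and \<open>a * (b + u') + 1\<close>,
  both at least 2.\<close>

lemma two_step_contraction:
  fixes a b u u' :: real
  assumes "a \<ge> 1" "b \<ge> 1" "0 \<le> u" "0 \<le> u'"
  shows "\<bar>1 / (a + 1 / (b + u)) - 1 / (a + 1 / (b + u'))\<bar> \<le> \<bar>u - u'\<bar> / 4"
proof -
  have pos: "b + u > 0" "b + u' > 0" using assms by linarith+
  have ge: "a * (b + u) + 1 \<ge> 2" "a * (b + u') + 1 \<ge> 2"
    using mult_mono[of 1 a 1 "b + u"] mult_mono[of 1 a 1 "b + u'"] assms by auto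
  have eq: "1 / (a + 1 / (b + x)) = (b + x) / (a * (b + x) + 1)" if "b + x > 0" for x
    using that by (simp add: field_simps)
  let ?d = "(a * (b + u) + 1) * (a * (b + u') + 1)"
  have d: "?d \<ge> 4"
    using mult_mono[OF ge] ge by simp
  have "(b + u) / (a * (b + u) + 1) - (b + u') / (a * (b + u') + 1) = (u - u') / ?d"
    using ge by (simp add: diff_frac_eq) (simp add: algebra_simps)
  then have "\<bar>1 / (a + 1 / (b + u)) - 1 / (a + 1 / (b + u'))\<bar> = \<bar>u - u'\<bar> / ?d"
    using d by (simp add: eq pos abs_divide)
  also have "\<dots> \<le> \<bar>u - u'\<bar> / 4"
    using d by (intro divide_left_mono) auto
  finally show ?thesis .
qed

text \<open>Both sequences lie in [0, 1], so iterating the two-step contraction bounds their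
  distance by every power of 1/4.\<close>

lemma cf_tails_unique:
  fixes a t t' :: "nat \<Rightarrow> real"
  assumes "\<And>n. a n \<ge> 1"
    and "\<And>n. 0 \<le> t n" "\<And>n. t n \<le> 1" "\<And>n. t n = 1 / (a n + t (Suc n))"
    and "\<And>n. 0 \<le> t' n" "\<And>n. t' n \<le> 1" "\<And>n. t' n = 1 / (a n + t' (Suc n))"
  shows "t n = t' n"
proof -
  have bound: "\<bar>t n - t' n\<bar> \<le> (1/4) ^ k" for n k
  proof (induction k arbitrary: n)
    case 0
    then show ?case
      using assms(2,3,5,6)[of n] by (auto simp: abs_le_iff)
  next
    case (Suc k)
    have "\<bar>t n - t' n\<bar> \<le> \<bar>t (Suc (Suc n)) - t' (Suc (Suc n))\<bar> / 4"
      using two_step_contraction[OF assms(1)[of n] assms(1)[of "Suc n"] assms(2) assms(5),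
          of "Suc (Suc n)" "Suc (Suc n)"]
      unfolding assms(4)[of "Suc n", symmetric] assms(4)[of n, symmetric]
        assms(7)[of "Suc n", symmetric] assms(7)[of n, symmetric] .
    then show ?case
      using Suc.IH[of "Suc (Suc n)"] by simp
  qed
  have "(\<lambda>k. (1/4::real) ^ k) \<longlonglongrightarrow> 0"
    by (rule LIMSEQ_realpow_zero) auto
  then have "\<bar>t n - t' n\<bar> \<le> 0"
    by (rule LIMSEQ_le_const) (use bound in blast)
  then show ?thesis by simp
qed

text \<open>The finite continued fraction with integer part 0 and partial quotients
  \<open>a n\<close>, ..., \<open>a (n + k - 1)\<close>.\<close>

primrec cf_trunc :: "(nat \<Rightarrow> real) \<Rightarrow> nat \<Rightarrow> nat \<Rightarrow> real" where
  "cf_trunc a n 0 = 0"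
| "cf_trunc a n (Suc k) = 1 / (a n + cf_trunc a (Suc n) k)"

text \<open>The tails are limits of the truncations, which are Cauchy by the two-step contraction.
  Positivity of the next tail then makes each tail less than 1.\<close>

lemma cf_tails_exist:
  fixes a :: "nat \<Rightarrow> real"
  assumes a: "\<And>n. a n \<ge> 1"
  obtains t where "\<And>n. 0 < t n" "\<And>n. t n < 1" "\<And>n. t n = 1 / (a n + t (Suc n))"
proof -
  let ?T = "cf_trunc a"
  have nonneg: "0 \<le> ?T n k" for n k
    by (induction k arbitrary: n) (use a in \<open>auto intro!: add_nonneg_nonneg intro: order_trans[OF zero_le_one]\<close>)
  have le1: "?T n k \<le> 1" for n k
  proof (cases k)
    case (Suc j)
    then show ?thesis
      using a[of n] nonneg[of "Suc n" j] by simp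
  qed simp
  have step: "\<bar>?T n (2 * k + i) - ?T n (2 * k + j)\<bar> \<le> (1/4) ^ k" for n k i j
  proof (induction k arbitrary: n)
    case 0
    then show ?case
      using nonneg[of n i] nonneg[of n j] le1[of n i] le1[of n j] by (auto simp: abs_le_iff)
  next
    case (Suc k)
    have "\<bar>?T n (2 * Suc k + i) - ?T n (2 * Suc k + j)\<bar>
        \<le> \<bar>?T (Suc (Suc n)) (2 * k + i) - ?T (Suc (Suc n)) (2 * k + j)\<bar> / 4"
      using two_step_contraction[OF a[of n] a[of "Suc n"] nonneg nonneg] by simp
    then show ?case
      using Suc.IH[of "Suc (Suc n)"] by simp
  qed
  have "Cauchy (?T n)" for n
  proof (rule CauchyI)
    fix e :: real
    assume "e > 0"
    then obtain k where k: "(1/4) ^ k < e"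
      using real_arch_pow_inv[of e "1/4"] by auto
    have "norm (?T n i - ?T n j) < e" if "i \<ge> 2 * k" "j \<ge> 2 * k" for i j
      using step[of n k "i - 2 * k" "j - 2 * k"] that k by simp
    then show "\<exists>M. \<forall>m\<ge>M. \<forall>n'\<ge>M. norm (?T n m - ?T n n') < e"
      by blast
  qed
  then have "\<exists>l. ?T n \<longlonglongrightarrow> l" for n
    by (simp add: Cauchy_convergent_iff convergent_def)
  then obtain t where t: "\<And>n. ?T n \<longlonglongrightarrow> t n"
    by metis
  have t0: "0 \<le> t n" for n
    using t[of n] by (rule LIMSEQ_le_const) (use nonneg in auto)
  have rec: "t n = 1 / (a n + t (Suc n))" for n
  proof (rule LIMSEQ_unique)
    show "(\<lambda>k. ?T n (Suc k)) \<longlonglongrightarrow> t n"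
      using t[of n] by (rule LIMSEQ_Suc)
    have "a n + t (Suc n) \<noteq> 0"
      using a[of n] t0[of "Suc n"] by linarith
    then show "(\<lambda>k. ?T n (Suc k)) \<longlonglongrightarrow> 1 / (a n + t (Suc n))"
      using t[of "Suc n"] by (auto intro!: tendsto_intros)
  qed
  have pos: "0 < t n" for n
    using a[of n] t0[of "Suc n"] by (subst rec) simp
  have "t n < 1" for n
    using a[of n] pos[of "Suc n"] by (subst rec) simp
  then show ?thesis
    using that pos rec by blast
qed

lemma cf_tails_irrational:
  fixes t :: "nat \<Rightarrow> real" and a :: "nat \<Rightarrow> nat"
  assumes t: "\<And>n. 0 < t n" "\<And>n. t n < 1" and rec: "\<And>n. t n = 1 / (real (a n) + t (Suc n))"
  shows "t n \<notin> \<rat>"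
proof
  assume "t n \<in> \<rat>"
  \<comment> \<open>Infinite descent: the numerator of one tail is the denominator of the next.\<close>
  have no: "t n * real s \<noteq> of_int r" if "s > 0" for n s and r :: int
    using that
  proof (induction s arbitrary: n r rule: less_induct)
    case (less s)
    show ?case
    proof
      assume eq: "t n * real s = of_int r"
      have "0 < t n * real s" "t n * real s < real s"
        using less.prems t[of n] by auto
      then have r: "0 < r" "r < int s"
        unfolding eq by linarith+
      have den: "real (a n) + t (Suc n) > 0"
        using t(1)[of "Suc n"] by (intro add_nonneg_pos) auto
      have "real s = (real (a n) + t (Suc n)) * of_int r"
        using eq rec[of n] den by (simp add: field_simps)
      then have "t (Suc n) * real (nat r) = of_int (int s - int (a n) * r)"
        using r by (simp add: algebra_simps)
      then show False
        using less.IH[of "nat r" "Suc n" "int s - int (a n) * r"] r by linarith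
    qed
  qed
  from \<open>t n \<in> \<rat>\<close> obtain r :: int and s :: int where "s > 0" "t n = of_int r / of_int s"
    by (rule Rats_cases')
  then have "t n * real (nat s) = of_int r" "nat s > 0"
    by (auto simp: field_simps)
  then show False
    using no by blast
qed

text \<open>Makes the definite description in \<open>cf_number\<close> meaningful: existence comes
  from the tails constructed above, uniqueness from the uniqueness of tails.\<close>

lemma ex1_cf:
  fixes a :: "nat \<Rightarrow> nat"
  assumes a: "\<And>n. n \<ge> 1 \<Longrightarrow> a n \<ge> 1"
  shows "\<exists>!\<alpha>. \<alpha> \<notin> \<rat> \<and> partial_quotient \<alpha> 0 = 0 \<and> (\<forall>n\<ge>1. partial_quotient \<alpha> n = int (a n))"
proof -
  have a': "real (a (Suc n)) \<ge> 1" for n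
    using a[of "Suc n"] by simp
  show ?thesis
  proof (rule ex_ex1I)
    obtain t where t: "\<And>n. 0 < t n" "\<And>n. t n < 1" "\<And>n. t n = 1 / (real (a (Suc n)) + t (Suc n))"
      by (rule cf_tails_exist[of "\<lambda>n. real (a (Suc n))"]) (use a' in blast)+
    \<comment> \<open>\<open>a 0\<close> is arbitrary, whereas the integer part has to be 0.\<close>
    define b where "b n = (if n = 0 then 0 else a n)" for n
    have cq: "complete_quotient (t 0) n = real (b n) + t n" for n
    proof (induction n)
      case 0
      then show ?case by (simp add: b_def)
    next
      case (Suc n)
      have "frac (real (b n) + t n) = t n"
        unfolding frac_unique_iff using t(1,2)[of n] by auto
      then have "complete_quotient (t 0) (Suc n) = 1 / t n"
        using Suc by simp
      also have "\<dots> = real (a (Suc n)) + t (Suc n)"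
        by (subst t(3)) simp
      finally show ?case by (simp add: b_def)
    qed
    have pq: "partial_quotient (t 0) n = int (b n)" for n
      unfolding partial_quotient_def cq using t(1,2)[of n] by (intro floor_unique) auto
    have "t 0 \<notin> \<rat>"
      using cf_tails_irrational[of t "\<lambda>n. a (Suc n)"] t by blast
    then show "\<exists>\<alpha>. \<alpha> \<notin> \<rat> \<and> partial_quotient \<alpha> 0 = 0 \<and> (\<forall>n\<ge>1. partial_quotient \<alpha> n = int (a n))"
      using pq by (intro exI[of _ "t 0"]) (auto simp: b_def)
  next
    \<comment> \<open>The fractional parts of the complete quotients satisfy the tail
      recursion.\<close>
    have tails: "frac (complete_quotient \<alpha> n) =
        1 / (real (a (Suc n)) + frac (complete_quotient \<alpha> (Suc n)))"
      if "\<forall>n\<ge>1. partial_quotient \<alpha> n = int (a n)" for \<alpha> n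
    proof -
      have "\<lfloor>complete_quotient \<alpha> (Suc n)\<rfloor> = int (a (Suc n))"
        using that by (simp add: partial_quotient_def del: complete_quotient.simps)
      then have "real (a (Suc n)) + frac (complete_quotient \<alpha> (Suc n)) = complete_quotient \<alpha> (Suc n)"
        by (simp add: frac_def del: complete_quotient.simps)
      then show ?thesis by simp
    qed
    fix \<alpha> \<beta> :: real
    assume \<alpha>: "\<alpha> \<notin> \<rat> \<and> partial_quotient \<alpha> 0 = 0 \<and> (\<forall>n\<ge>1. partial_quotient \<alpha> n = int (a n))"
      and \<beta>: "\<beta> \<notin> \<rat> \<and> partial_quotient \<beta> 0 = 0 \<and> (\<forall>n\<ge>1. partial_quotient \<beta> n = int (a n))"
    have "frac (complete_quotient \<alpha> 0) = frac (complete_quotient \<beta> 0)"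
    proof (rule cf_tails_unique[of "\<lambda>n. real (a (Suc n))"])
      fix n
      show "frac (complete_quotient \<alpha> n) = 1 / (real (a (Suc n)) + frac (complete_quotient \<alpha> (Suc n)))"
        "frac (complete_quotient \<beta> n) = 1 / (real (a (Suc n)) + frac (complete_quotient \<beta> (Suc n)))"
        using tails \<alpha> \<beta> by blast+
    qed (use a' in \<open>simp_all add: less_imp_le[OF frac_lt_1]\<close>)
    then show "\<alpha> = \<beta>"
      using \<alpha> \<beta> by (simp add: partial_quotient_def frac_def)
  qed
qed

subsection \<open>Carries of Ostrowski addition\<close>

text \<open>The index is shifted by one: \<open>denom a (Suc n)\<close> is \<open>q\<^sub>n\<close>, and \<open>a n\<close> is \<open>a\<^sub>n\<^sub>+\<^sub>1\<close>.\<close>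

fun denom :: "(nat \<Rightarrow> int) \<Rightarrow> nat \<Rightarrow> int" where
  "denom a 0 = 0"
| "denom a (Suc 0) = 1"
| "denom a (Suc (Suc n)) = a n * denom a (Suc n) + denom a n"

lemma cf_denom_eq_denom: "cf_denom \<alpha> n = denom (\<lambda>n. partial_quotient \<alpha> (Suc n)) (Suc n)"
  by (induction \<alpha> n rule: cf_denom.induct) auto

section \<open>Growth of the denominators\<close>

lemma denom_nonneg:
  assumes "\<And>n. a n \<ge> 0"
  shows "denom a n \<ge> 0"
  using assms by (induction a n rule: denom.induct) auto

lemma denom_pos:
  assumes "\<And>n. a n \<ge> 1"
  shows "denom a (Suc n) > 0"
proof (induction n)
  case (Suc n)
  have "denom a n \<ge> 0"
    by (rule denom_nonneg) (use assms in \<open>force intro: order_trans[OF zero_le_one]\<close>)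
  then show ?case
    using Suc assms[of n] by (auto intro!: add_pos_nonneg mult_pos_pos)
qed simp

lemma denom_add_le:
  assumes "\<And>n. a n \<ge> 1"
  shows "denom a (Suc n) + denom a n \<le> denom a (Suc (Suc n))"
  using mult_right_mono[of 1 "a n" "denom a (Suc n)"] assms[of n] denom_pos[of a n, OF assms] by simp

lemma denom_le_Suc:
  assumes "\<And>n. a n \<ge> 1"
  shows "denom a n \<le> denom a (Suc n)"
proof (cases n)
  case (Suc m)
  have "denom a m \<ge> 0"
    by (rule denom_nonneg) (use assms in \<open>force intro: order_trans[OF zero_le_one]\<close>)
  then show ?thesis
    using denom_add_le[of a m, OF assms] Suc by simp
qed simp

text \<open>Uses the same shift as \<open>a\<close> in \<open>denom\<close>: \<open>x n\<close> is
  the digit \<open>b (n + 1)\<close>. Eventual vanishing of the digits is stated separately where it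
  matters.\<close>

definition ostrowski_digits :: "(nat \<Rightarrow> int) \<Rightarrow> (nat \<Rightarrow> int) \<Rightarrow> bool" where
  "ostrowski_digits a x \<longleftrightarrow> x 0 < a 0 \<and> (\<forall>n. 0 \<le> x n \<and> x n \<le> a n) \<and>
     (\<forall>n. x (Suc n) = a (Suc n) \<longrightarrow> x n = 0)"

lemma ostrowski_digits_sum_nonneg:
  assumes "\<And>n. a n \<ge> 1" "ostrowski_digits a x"
  shows "0 \<le> (\<Sum>n<k. x n * denom a (Suc n))"
  using assms(2) denom_pos[of a, OF assms(1)]
  by (intro sum_nonneg mult_nonneg_nonneg) (auto simp: ostrowski_digits_def intro: less_imp_le)

text \<open>Strong induction on the number of terms. If the top digit is below its bound, there is
  room for one more \<open>denom a (Suc m)\<close>, which exceeds the rest; if it is maximal, the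
  digit below it is zero and the hypothesis applies two levels down.\<close>

lemma ostrowski_digits_sum_less:
  assumes a: "\<And>n. a n \<ge> 1" and x: "ostrowski_digits a x"
  shows "(\<Sum>n<k. x n * denom a (Suc n)) < denom a (Suc k)"
proof (induction k rule: less_induct)
  case (less k)
  let ?S = "\<lambda>k. \<Sum>n<k. x n * denom a (Suc n)"
  show ?case
  proof (cases k)
    case 0
    then show ?thesis by simp
  next
    case (Suc m)
    have IH: "?S m < denom a (Suc m)"
      using less Suc by simp
    have "denom a m \<ge> 0"
      by (rule denom_nonneg) (use a in \<open>force intro: order_trans[OF zero_le_one]\<close>)
    show ?thesis
    proof (cases "x m < a m")
      case True
      then have "x m * denom a (Suc m) + denom a (Suc m) \<le> a m * denom a (Suc m)"
        using mult_right_mono[of "x m + 1" "a m" "denom a (Suc m)"] denom_pos[of a m, OF a]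
        by (simp add: algebra_simps)
      then show ?thesis
        using IH \<open>denom a m \<ge> 0\<close> Suc by simp
    next
      case False
      then have eq: "x m = a m"
        using x by (auto simp: ostrowski_digits_def intro: order_antisym)
      then obtain j where j: "m = Suc j"
        using x by (cases m) (auto simp: ostrowski_digits_def)
      then have "x j = 0"
        using x eq by (simp add: ostrowski_digits_def)
      moreover have "?S j < denom a (Suc j)"
        using less Suc j by simp
      ultimately show ?thesis
        using eq Suc j by simp
    qed
  qed
qed

text \<open>The recursion computes the carries downwards from zeros at the top; the induction
  removes the lowest index by shifting both sequences.\<close>

lemma carry_exists:
  fixes a d :: "nat \<Rightarrow> int"
  assumes "\<forall>n\<ge>N. d n = 0"
  shows "\<exists>A. (\<forall>n\<ge>N. A n = 0) \<and> (\<forall>k. A k = A (Suc k) * a k + A (Suc (Suc k)) + d k)"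
  using assms
proof (induction N arbitrary: a d)
  case 0
  then show ?case
    by (intro exI[of _ "\<lambda>_. 0"]) auto
next
  case (Suc N)
  then obtain A where A: "\<forall>n\<ge>N. A n = 0"
    "\<forall>k. A k = A (Suc k) * a (Suc k) + A (Suc (Suc k)) + d (Suc k)"
    using Suc.IH[of "\<lambda>n. d (Suc n)" "\<lambda>n. a (Suc n)"] Suc_le_mono by blast
  define B where "B n = (case n of 0 \<Rightarrow> A 0 * a 0 + A 1 + d 0 | Suc n \<Rightarrow> A n)" for n
  have "B n = 0" if "n \<ge> Suc N" for n
    using that A(1) by (cases n) (auto simp: B_def)
  moreover have "B k = B (Suc k) * a k + B (Suc (Suc k)) + d k" for k
  proof (cases k)
    case (Suc m)
    then show ?thesis
      using spec[OF A(2), of m] by (simp add: B_def)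
  qed (simp add: B_def)
  ultimately show ?case
    by blast
qed

text \<open>Horner invariant: unfolding \<open>A k\<close> by its recursion moves \<open>d k\<close>
  into the sum, and the coefficient of \<open>A (Suc k)\<close> becomes
  \<open>denom a (Suc (Suc k))\<close>.\<close>

lemma carry_telescope:
  fixes a d A :: "nat \<Rightarrow> int"
  assumes "\<forall>k. A k = A (Suc k) * a k + A (Suc (Suc k)) + d k"
  shows "(\<Sum>n<k. d n * denom a (Suc n)) + A k * denom a (Suc k) + A (Suc k) * denom a k = A 0"
proof (induction k)
  case (Suc k)
  have "A k = A (Suc k) * a k + A (Suc (Suc k)) + d k"
    using assms by blast
  then have "A k * denom a (Suc k) =
      (A (Suc k) * a k + A (Suc (Suc k)) + d k) * denom a (Suc k)"
    by simp
  then show ?case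
    using Suc.IH by (simp add: algebra_simps)
qed simp

text \<open>Two steps of the estimate \<open>\<bar>A\<^sub>k\<bar> q\<^sub>k \<le> 2 q\<^sub>k + \<bar>A\<^sub>k\<^sub>+\<^sub>1\<bar> q\<^sub>k\<^sub>-\<^sub>1\<close> gain a factor \<open>q\<^sub>k\<^sub>-\<^sub>1 / q\<^sub>k\<^sub>+\<^sub>1 \<le> 1/2\<close>,
  so the bound 8 propagates downwards from the zero carries at the top.\<close>

lemma carry_bounded:
  fixes a A :: "nat \<Rightarrow> int"
  assumes a: "\<And>n. a n \<ge> 1"
    and top: "\<forall>n\<ge>N. A n = 0"
    and step: "\<And>k. \<bar>A k * denom a (Suc k) + A (Suc k) * denom a k\<bar> \<le> 2 * denom a (Suc k)"
  shows "\<bar>A k\<bar> \<le> 8"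
proof -
  have nn: "denom a n \<ge> 0" for n
    by (rule denom_nonneg) (use a in \<open>force intro: order_trans[OF zero_le_one]\<close>)
  have est: "\<bar>A k\<bar> * denom a (Suc k) \<le> 2 * denom a (Suc k) + \<bar>A (Suc k)\<bar> * denom a k" for k
  proof -
    have "\<bar>A k * denom a (Suc k)\<bar> \<le> \<bar>A k * denom a (Suc k) + A (Suc k) * denom a k\<bar> + \<bar>A (Suc k) * denom a k\<bar>"
      by linarith
    then show ?thesis
      using step[of k] nn[of k] nn[of "Suc k"] by (simp add: abs_mult)
  qed
  \<comment> \<open>Two consecutive carries are bounded together, because the estimate is applied
    twice per step.\<close>
  have "\<bar>A k\<bar> \<le> 8 \<and> \<bar>A (Suc k)\<bar> \<le> 8" if "k \<le> N" for k
    using that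
  proof (induction k rule: inc_induct)
    case base
    then show ?case using top by simp
  next
    case (step k)
    let ?r = "denom a k" and ?s = "denom a (Suc k)" and ?t = "denom a (Suc (Suc k))"
    let ?\<alpha> = "\<bar>A k\<bar>" and ?\<beta> = "\<bar>A (Suc k)\<bar>" and ?\<gamma> = "\<bar>A (Suc (Suc k))\<bar>"
    have le: "?r \<le> ?s" "2 * ?r \<le> ?t" "0 < ?s" "0 < ?t" "0 \<le> ?r"
      using denom_le_Suc[of a k, OF a] denom_add_le[of a k, OF a] denom_pos[of a, OF a] nn[of k]
      by (simp_all del: denom.simps(3))
    have "?\<gamma> * ?s \<le> 8 * ?s"
      using step.IH le by (intro mult_right_mono) auto
    then have \<beta>: "?\<beta> * ?t \<le> 2 * ?t + 8 * ?s"
      using est[of "Suc k"] by linarith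
    have "?\<alpha> \<le> 8"
    proof (rule ccontr)
      assume "\<not> ?\<alpha> \<le> 8"
      \<comment> \<open>From here the estimates yield \<open>7 * ?s * ?t \<le> 6 * ?s * ?t\<close>,
        by \<open>?r \<le> ?s\<close> and \<open>2 * ?r \<le> ?t\<close>.\<close>
      then have "9 * ?s \<le> ?\<alpha> * ?s"
        using le by (intro mult_right_mono) auto
      then have "7 * ?s \<le> ?\<beta> * ?r"
        using est[of k] by linarith
      then have "7 * ?s * ?t \<le> ?\<beta> * ?r * ?t"
        using le by (intro mult_right_mono) auto
      also have "\<dots> = ?r * (?\<beta> * ?t)"
        by simp
      also have "\<dots> \<le> ?r * (2 * ?t + 8 * ?s)"
        using \<beta> le by (intro mult_left_mono) auto
      also have "\<dots> = 2 * (?r * ?t) + 4 * (?s * (2 * ?r))"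
        by (simp add: algebra_simps)
      also have "\<dots> \<le> 2 * (?s * ?t) + 4 * (?s * ?t)"
        using le by (intro add_mono mult_left_mono mult_right_mono) auto
      finally have "?s * ?t \<le> 0"
        by (simp add: algebra_simps)
      then show False
        using le mult_pos_pos[of ?s ?t] by linarith
    qed
    then show ?case
      using step.IH by simp
  qed
  then show ?thesis
    using top by (cases "k \<le> N") auto
qed

text \<open>The telescoped identity at \<open>k = N\<close> equates the digit sum with
  \<open>A 0\<close>, because the carries vanish from \<open>N\<close> on. At intermediate
  \<open>k\<close> it makes the upper part the negative of a truncated sum, which yields the bound
  8.\<close>

lemma ostrowski_sum_eq_iff_carry:
  fixes a x y z :: "nat \<Rightarrow> int"
  assumes a: "\<And>n. a n \<ge> 1"
    and x: "ostrowski_digits a x" and y: "ostrowski_digits a y" and z: "ostrowski_digits a z"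
    and fin: "\<forall>n\<ge>N. x n = 0 \<and> y n = 0 \<and> z n = 0"
  shows "(\<Sum>n<N. x n * denom a (Suc n)) + (\<Sum>n<N. y n * denom a (Suc n)) =
      (\<Sum>n<N. z n * denom a (Suc n)) \<longleftrightarrow>
    (\<exists>A. A 0 = 0 \<and> (\<forall>k. \<bar>A k\<bar> \<le> 8) \<and>
      (\<forall>k. A k = A (Suc k) * a k + A (Suc (Suc k)) + (x k + y k - z k)) \<and>
      (\<forall>k\<ge>N. A k = 0))"
    (is "?sum \<longleftrightarrow> ?carry")
proof -
  define d where "d n = x n + y n - z n" for n
  have d: "(\<Sum>n<k. d n * denom a (Suc n)) = (\<Sum>n<k. x n * denom a (Suc n)) +
      (\<Sum>n<k. y n * denom a (Suc n)) - (\<Sum>n<k. z n * denom a (Suc n))" for k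
    by (simp add: d_def algebra_simps sum.distrib sum_subtractf)
  show ?thesis
  proof
    assume sum: ?sum
    have "\<forall>n\<ge>N. d n = 0"
      using fin by (simp add: d_def)
    then obtain A where A: "\<forall>n\<ge>N. A n = 0" "\<forall>k. A k = A (Suc k) * a k + A (Suc (Suc k)) + d k"
      using carry_exists[of N d a] by blast
    have A0: "A 0 = 0"
      using carry_telescope[OF A(2), of N] A(1) sum d[of N] by simp
    have "\<bar>A k * denom a (Suc k) + A (Suc k) * denom a k\<bar> \<le> 2 * denom a (Suc k)" for k
      using carry_telescope[OF A(2), of k] A0 d[of k]
        ostrowski_digits_sum_nonneg[OF a x, of k] ostrowski_digits_sum_less[OF a x, of k]
        ostrowski_digits_sum_nonneg[OF a y, of k] ostrowski_digits_sum_less[OF a y, of k]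
        ostrowski_digits_sum_nonneg[OF a z, of k] ostrowski_digits_sum_less[OF a z, of k]
      by linarith
    then have "\<bar>A k\<bar> \<le> 8" for k
      by (rule carry_bounded[OF a A(1)])
    then show ?carry
      using A A0 unfolding d_def by blast
  next
    assume ?carry
    then obtain A where A: "A 0 = 0" "\<forall>k\<ge>N. A k = 0"
      "\<forall>k. A k = A (Suc k) * a k + A (Suc (Suc k)) + d k"
      unfolding d_def by blast
    show ?sum
      using carry_telescope[OF A(3), of N] A(1,2) d[of N] by simp
  qed
qed

subsection \<open>Words and digits\<close>

lemma enumerate_range_strict_mono:
  fixes h :: "nat \<Rightarrow> nat"
  assumes "strict_mono h"
  shows "enumerate (range h) = h"
proof
  fix n
  have inf: "infinite (range h)"
    using assms by (simp add: range_inj_infinite strict_mono_imp_inj_on)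
  show "enumerate (range h) n = h n"
  proof (induction n)
    case 0
    show ?case
      unfolding enumerate_0
      by (rule Least_equality) (auto simp: strict_mono_less_eq[OF assms])
  next
    case (Suc n)
    show ?case
      unfolding enumerate_Suc''[OF inf] Suc
      by (rule Least_equality) (auto simp: strict_mono_less[OF assms] strict_mono_less_eq[OF assms])
  qed
qed

text \<open>Sharing one \<open>h\<close> between words expresses that they are aligned.\<close>

definition hash_cut :: "(nat \<Rightarrow> nat) \<Rightarrow> letter word \<Rightarrow> bool" where
  "hash_cut h w \<longleftrightarrow> h 0 = 0 \<and> strict_mono h \<and> hash_positions w = range h"

lemma subsequence_Cons: "i < j \<Longrightarrow> subsequence w i j = w i # subsequence w (Suc i) j"
  by (simp add: subsequence_def upt_conv_Cons)

lemma strict_mono_interval: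
  fixes h :: "nat \<Rightarrow> nat"
  assumes "h 0 = 0" "strict_mono h"
  obtains n where "h n \<le> i" "i < h (Suc n)"
proof -
  have "\<exists>n. h n \<le> i \<and> i < h (Suc n)"
  proof (induction i)
    case 0
    then show ?case
      using assms by (metis le_refl strict_mono_Suc_iff)
  next
    case (Suc i)
    then obtain n where "h n \<le> i" "i < h (Suc n)"
      by blast
    moreover have "h (Suc n) < h (Suc (Suc n))"
      using assms by (simp add: strict_mono_Suc_iff)
    ultimately show ?case
      by (cases "Suc i < h (Suc n)") (auto intro: exI[of _ n] exI[of _ "Suc n"])
  qed
  then show ?thesis
    using that by blast
qed

text \<open>The global condition on the positions of \<open>#\<close> becomes a condition on each
  factor, which an automaton can test. Conversely, every position lies in some factor, so no further
  \<open>#\<close> can occur.\<close>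

lemma hash_cut_iff:
  assumes h: "h 0 = 0" "strict_mono h"
  shows "hash_cut h w \<longleftrightarrow>
    (\<forall>n. w (h n) = Hash \<and> set (subsequence w (Suc (h n)) (h (Suc n))) \<subseteq> {Zero, One})"
proof -
  have letters: "c \<in> {Zero, One} \<longleftrightarrow> c \<noteq> Hash" for c
    by (cases c) auto
  show ?thesis
  proof
    assume "hash_cut h w"
    then have "w i = Hash \<longleftrightarrow> i \<in> range h" for i
      by (auto simp: hash_cut_def hash_positions_def)
    then show "\<forall>n. w (h n) = Hash \<and> set (subsequence w (Suc (h n)) (h (Suc n))) \<subseteq> {Zero, One}"
      by (auto simp: letters subset_iff Suc_le_eq strict_mono_less[OF h(2)] simp del: insert_iff)
  next
    assume *: "\<forall>n. w (h n) = Hash \<and> set (subsequence w (Suc (h n)) (h (Suc n))) \<subseteq> {Zero, One}"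
    have "i \<in> range h" if "w i = Hash" for i
    proof -
      obtain n where n: "h n \<le> i" "i < h (Suc n)"
        using strict_mono_interval[OF h] .
      have "i = h n"
      proof (rule ccontr)
        assume "i \<noteq> h n"
        then have "w i \<in> set (subsequence w (Suc (h n)) (h (Suc n)))"
          using n by auto
        then show False
          using * that by fastforce
      qed
      then show ?thesis by blast
    qed
    then show "hash_cut h w"
      using * h by (auto simp: hash_cut_def hash_positions_def)
  qed
qed

lemma hash_words_iff: "w \<in> hash_words \<longleftrightarrow> (\<exists>h. hash_cut h w)"
proof -
  have "(\<forall>n. subsequence w (h n) (h (Suc n)) \<in> {Hash # x | x. set x \<subseteq> {Zero, One}}) \<longleftrightarrow> hash_cut h w"
    if "h 0 = 0" "strict_mono h" for h
    unfolding hash_cut_iff[OF that] using that(2)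
    by (auto simp: subsequence_Cons strict_mono_Suc_iff simp del: set_subsequence)
  then show ?thesis
    unfolding hash_words_def omega_power_def
    by (auto simp: hash_cut_def)
qed

lemma block_hash_cut:
  assumes "hash_cut h w"
  shows "block w (Suc n) = subsequence w (Suc (h n)) (h (Suc n))"
  using assms enumerate_range_strict_mono[of h] by (simp add: hash_cut_def block_def)

lemma bin_value_Nil: "bin_value [] = 0"
  by (simp add: bin_value_def)

lemma bin_value_Cons: "bin_value (c # b) = bit_value c + 2 * bin_value b"
  unfolding bin_value_def by (simp add: sum.lessThan_Suc_shift sum_distrib_left algebra_simps del: sum.lessThan_Suc)

lemma weight_value_bit:
  "weight_value (\<lambda>l. int (bit_value (f l))) b = int (bin_value (map f b))"
  by (induction b) (auto simp: bin_value_Nil bin_value_Cons)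

lemma bin_value_pos_iff: "bin_value b > 0 \<longleftrightarrow> One \<in> set b"
  by (induction b) (auto simp: bin_value_Nil bin_value_Cons bit_value_def)

text \<open>A block over \<open>Zero\<close> and \<open>One\<close> has the required shape exactly
  if it contains \<open>One\<close>, that is, if its value is positive.\<close>

lemma R_iff: "w \<in> R \<longleftrightarrow> (\<exists>h. hash_cut h w) \<and> (\<forall>n. block_value w (Suc n) > 0)"
proof -
  let ?L = "{Hash # x @ [One] @ y | x y. set x \<subseteq> {Zero, One} \<and> set y \<subseteq> {Zero, One}}"
  have L: "c # b \<in> ?L \<longleftrightarrow> c = Hash \<and> set b \<subseteq> {Zero, One} \<and> One \<in> set b" for c b
  proof
    assume R: "c = Hash \<and> set b \<subseteq> {Zero, One} \<and> One \<in> set b"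
    then obtain x y where "b = x @ One # y"
      by (meson split_list)
    then show "c # b \<in> ?L"
      using R by auto
  qed auto
  have "(\<forall>n. subsequence w (h n) (h (Suc n)) \<in> ?L) \<longleftrightarrow>
      hash_cut h w \<and> (\<forall>n. One \<in> set (subsequence w (Suc (h n)) (h (Suc n))))"
    if "h 0 = 0" "strict_mono h" for h
  proof -
    have "subsequence w (h n) (h (Suc n)) = w (h n) # subsequence w (Suc (h n)) (h (Suc n))" for n
      using that(2) by (simp add: subsequence_Cons strict_mono_Suc_iff)
    then show ?thesis
      unfolding hash_cut_iff[OF that] L by (simp only: L) blast
  qed
  moreover have "hash_cut h w \<Longrightarrow> h 0 = 0 \<and> strict_mono h" for h
    by (simp add: hash_cut_def)
  ultimately have "w \<in> R \<longleftrightarrow> (\<exists>h. hash_cut h w \<and>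
      (\<forall>n. One \<in> set (subsequence w (Suc (h n)) (h (Suc n)))))"
    unfolding R_def omega_power_def mem_Collect_eq by meson
  also have "\<dots> \<longleftrightarrow> (\<exists>h. hash_cut h w \<and> (\<forall>n. block_value w (Suc n) > 0))"
    by (auto simp: block_value_def bin_value_pos_iff block_hash_cut simp del: set_subsequence)
  finally show ?thesis by blast
qed

text \<open>Integers rather than naturals, because differences of digits occur; the index starts at
  0, while blocks are numbered from 1.\<close>

definition digits :: "letter word \<Rightarrow> nat \<Rightarrow> int" where
  "digits w n = int (block_value w (Suc n))"

lemma partial_quotient_cf_number:
  assumes "v \<in> R"
  shows "partial_quotient (cf_number v) (Suc n) = digits v n"
proof -
  have "block_value v n \<ge> 1" if "n \<ge> 1" for n
    using assms that by (cases n) (auto simp: R_iff Suc_le_eq)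
  then show ?thesis
    using theI'[OF ex1_cf[of "block_value v"]] unfolding cf_number_def digits_def by auto
qed

lemma ostrowski_rep_iff:
  assumes v: "v \<in> R"
  shows "ostrowski_rep (cf_number v) (block_value w) X \<longleftrightarrow>
    ostrowski_digits (digits v) (digits w) \<and>
    (\<exists>N. (\<forall>n\<ge>N. digits w n = 0) \<and> int X = (\<Sum>n<N. digits w n * denom (digits v) (Suc n)))"
proof -
  let ?f = "\<lambda>n. digits w n * denom (digits v) (Suc n)"
  have pq: "partial_quotient (cf_number v) (Suc n) = digits v n" for n
    using partial_quotient_cf_number[OF v] .
  have q: "cf_denom (cf_number v) n = denom (digits v) (Suc n)" for n
    by (simp add: cf_denom_eq_denom pq)
  have "(\<exists>N. (\<forall>n>N. block_value w (n + 1) = 0) \<and>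
      int X = (\<Sum>n=0..N. int (block_value w (n + 1)) * cf_denom (cf_number v) n)) \<longleftrightarrow>
    (\<exists>N. (\<forall>n>N. digits w n = 0) \<and> int X = (\<Sum>n<Suc N. ?f n))"
    by (simp add: q digits_def atLeast0AtMost lessThan_Suc_atMost del: sum.lessThan_Suc)
  \<comment> \<open>The sums on the left include the index \<open>N\<close>: one direction takes
    \<open>Suc N\<close> as cutoff, the other appends a zero term.\<close>
  also have "\<dots> \<longleftrightarrow> (\<exists>N. (\<forall>n\<ge>N. digits w n = 0) \<and> int X = (\<Sum>n<N. ?f n))"
  proof
    assume "\<exists>N. (\<forall>n>N. digits w n = 0) \<and> int X = (\<Sum>n<Suc N. ?f n)"
    then show "\<exists>N. (\<forall>n\<ge>N. digits w n = 0) \<and> int X = (\<Sum>n<N. ?f n)"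
      by (meson Suc_le_lessD)
  next
    assume "\<exists>N. (\<forall>n\<ge>N. digits w n = 0) \<and> int X = (\<Sum>n<N. ?f n)"
    then obtain N where "\<forall>n\<ge>N. digits w n = 0" "int X = (\<Sum>n<N. ?f n)"
      by blast
    then show "\<exists>N. (\<forall>n>N. digits w n = 0) \<and> int X = (\<Sum>n<Suc N. ?f n)"
      by (intro exI[of _ N]) simp
  qed
  moreover have "(int (block_value w 1) < partial_quotient (cf_number v) 1 \<and>
     (\<forall>n. int (block_value w (n + 1)) \<le> partial_quotient (cf_number v) (n + 1)) \<and>
     (\<forall>n\<ge>1. int (block_value w (n + 1)) = partial_quotient (cf_number v) (n + 1) \<longrightarrow>
        block_value w n = 0)) \<longleftrightarrow> ostrowski_digits (digits v) (digits w)"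
  proof -
    have shift: "(\<forall>n\<ge>1. P n) \<longleftrightarrow> (\<forall>n. P (Suc n))" for P
      by (metis Suc_le_D Suc_le_mono One_nat_def le0)
    show ?thesis
      unfolding shift ostrowski_digits_def using pq[of 0] by (simp add: pq) (simp add: digits_def)
  qed
  ultimately show ?thesis
    unfolding ostrowski_rep_def by blast
qed

lemma sum_digits_eq:
  fixes f :: "nat \<Rightarrow> int"
  assumes "\<forall>n\<ge>M. f n = 0" "M \<le> N"
  shows "(\<Sum>n<N. f n) = (\<Sum>n<M. f n)"
  by (rule sum.mono_neutral_right) (use assms in auto)

lemma digits_R_ge_1: "v \<in> R \<Longrightarrow> digits v n \<ge> 1"
  by (simp add: R_iff digits_def Suc_le_eq)

text \<open>Any cutoff beyond the last nonzero digit gives the same sum, so the digits determine the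
  number.\<close>

lemma Z_eq:
  assumes v: "v \<in> R" and w: "ostrowski_digits (digits v) (digits w)"
    and N: "\<forall>n\<ge>N. digits w n = 0"
  shows "int (Z v w) = (\<Sum>n<N. digits w n * denom (digits v) (Suc n))"
proof -
  let ?f = "\<lambda>n. digits w n * denom (digits v) (Suc n)"
  let ?X = "nat (\<Sum>n<N. ?f n)"
  have nonneg: "0 \<le> (\<Sum>n<N. ?f n)"
    by (rule ostrowski_digits_sum_nonneg[OF digits_R_ge_1[OF v] w])
  have "Z v w = ?X"
    unfolding Z_def
  proof (rule the_equality)
    show "ostrowski_rep (cf_number v) (block_value w) ?X"
      unfolding ostrowski_rep_iff[OF v] using w N nonneg by auto
    fix X
    assume "ostrowski_rep (cf_number v) (block_value w) X"
    then obtain M where M: "\<forall>n\<ge>M. digits w n = 0" "int X = (\<Sum>n<M. ?f n)"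
      unfolding ostrowski_rep_iff[OF v] by blast
    then have "(\<Sum>n<M. ?f n) = (\<Sum>n<N. ?f n)"
      using N sum_digits_eq[of M ?f "max M N"] sum_digits_eq[of N ?f "max M N"] by simp
    then show "X = ?X"
      using M(2) by simp
  qed
  then show ?thesis
    using nonneg by simp
qed

lemma A_fin_iff:
  assumes v: "v \<in> R" and h: "hash_cut h v"
  shows "w \<in> A_fin v \<longleftrightarrow> hash_cut h w \<and> ostrowski_digits (digits v) (digits w) \<and>
    (\<exists>N. \<forall>n\<ge>N. digits w n = 0)"
proof -
  have "w \<in> hash_words \<and> aligned w v \<longleftrightarrow> hash_cut h w"
    using h by (auto simp: hash_words_iff aligned_def hash_cut_def)
  moreover have "(\<exists>X. ostrowski_rep (cf_number v) (block_value w) X) \<longleftrightarrow>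
      ostrowski_digits (digits v) (digits w) \<and> (\<exists>N. \<forall>n\<ge>N. digits w n = 0)"
  proof
    assume R: "ostrowski_digits (digits v) (digits w) \<and> (\<exists>N. \<forall>n\<ge>N. digits w n = 0)"
    then show "\<exists>X. ostrowski_rep (cf_number v) (block_value w) X"
      using Z_eq[OF v] unfolding ostrowski_rep_iff[OF v] by blast
  qed (auto simp: ostrowski_rep_iff[OF v])
  ultimately show ?thesis
    unfolding A_fin_def by blast
qed

text \<open>Continued fractions are eliminated here: what remains are aligned cuts and conditions on
  integer sequences, with one cutoff \<open>N\<close> for digits and carries.\<close>

lemma oplus_fin_iff:
  "(v, x, y, z) \<in> oplus_fin \<longleftrightarrow>
    (\<exists>h. hash_cut h v \<and> hash_cut h x \<and> hash_cut h y \<and> hash_cut h z) \<and> (\<forall>n. digits v n \<ge> 1) \<and>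
    ostrowski_digits (digits v) (digits x) \<and> ostrowski_digits (digits v) (digits y) \<and>
    ostrowski_digits (digits v) (digits z) \<and>
    (\<exists>N A. (\<forall>n\<ge>N. digits x n = 0 \<and> digits y n = 0 \<and> digits z n = 0 \<and> A n = 0) \<and>
      A 0 = 0 \<and> (\<forall>k. \<bar>A k\<bar> \<le> 8) \<and>
      (\<forall>k. A k = A (Suc k) * digits v k + A (Suc (Suc k)) + (digits x k + digits y k - digits z k)))"
    (is "?L \<longleftrightarrow> ?R")
proof -
  have sum: "Z v x + Z v y = Z v z \<longleftrightarrow>
      (\<exists>A. A 0 = 0 \<and> (\<forall>k. \<bar>A k\<bar> \<le> 8) \<and>
      (\<forall>k. A k = A (Suc k) * digits v k + A (Suc (Suc k)) + (digits x k + digits y k - digits z k)) \<and>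
      (\<forall>k\<ge>N. A k = 0))"
    if v: "v \<in> R" and x: "ostrowski_digits (digits v) (digits x)"
      and y: "ostrowski_digits (digits v) (digits y)" and z: "ostrowski_digits (digits v) (digits z)"
      and N: "\<forall>n\<ge>N. digits x n = 0 \<and> digits y n = 0 \<and> digits z n = 0" for N
  proof -
    have "Z v x + Z v y = Z v z \<longleftrightarrow> int (Z v x) + int (Z v y) = int (Z v z)"
      by linarith
    then show ?thesis
      unfolding ostrowski_sum_eq_iff_carry[OF digits_R_ge_1[OF v] x y z N, symmetric]
      using Z_eq[OF v x, of N] Z_eq[OF v y, of N] Z_eq[OF v z, of N] N by simp
  qed
  show ?thesis
  proof
    assume ?L
    then have v: "v \<in> R" and xyz: "x \<in> A_fin v" "y \<in> A_fin v" "z \<in> A_fin v"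
      and eq: "Z v x + Z v y = Z v z"
      by (auto simp: oplus_fin_def)
    obtain h where h: "hash_cut h v"
      using v by (auto simp: R_iff)
    note A = xyz[unfolded A_fin_iff[OF v h]]
    obtain N1 N2 N3 where "\<forall>n\<ge>N1. digits x n = 0" "\<forall>n\<ge>N2. digits y n = 0" "\<forall>n\<ge>N3. digits z n = 0"
      using A by blast
    then have N: "\<forall>n\<ge>max N1 (max N2 N3). digits x n = 0 \<and> digits y n = 0 \<and> digits z n = 0"
      by simp
    have "\<forall>n. digits v n \<ge> 1"
      using digits_R_ge_1[OF v] by blast
    moreover have "\<exists>h. hash_cut h v \<and> hash_cut h x \<and> hash_cut h y \<and> hash_cut h z"
      using h A by blast
    ultimately show ?R
      using A eq[unfolded sum[OF v A(1)[THEN conjunct2, THEN conjunct1]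
        A(2)[THEN conjunct2, THEN conjunct1] A(3)[THEN conjunct2, THEN conjunct1] N]] N
      by meson
  next
    assume R: ?R
    then obtain h where h: "hash_cut h v" "hash_cut h x" "hash_cut h y" "hash_cut h z"
      by blast
    have "block_value v (Suc n) > 0" for n
    proof -
      have "digits v n \<ge> 1" using R by blast
      then show ?thesis by (simp add: digits_def)
    qed
    then have v: "v \<in> R"
      using h by (auto simp: R_iff)
    obtain N A where N: "\<forall>n\<ge>N. digits x n = 0 \<and> digits y n = 0 \<and> digits z n = 0 \<and> A n = 0"
      and A: "A 0 = 0 \<and> (\<forall>k. \<bar>A k\<bar> \<le> 8) \<and>
      (\<forall>k. A k = A (Suc k) * digits v k + A (Suc (Suc k)) + (digits x k + digits y k - digits z k))"
      using R by blast
    have "Z v x + Z v y = Z v z"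
      by (subst sum[of N]) (use v R N A in blast)+
    moreover have "x \<in> A_fin v" "y \<in> A_fin v" "z \<in> A_fin v"
      unfolding A_fin_iff[OF v h(1)] using h R N by blast+
    ultimately show ?L
      using v by (simp add: oplus_fin_def)
  qed
qed

subsection \<open>The adder\<close>

text \<open>At the start of block \<open>n + 1\<close> the state consists of the carries \<open>A\<^sub>n\<close> and \<open>A\<^sub>n\<^sub>+\<^sub>1\<close>, one flag per
  word telling whether the next digit may be maximal, and a flag that is guessed once all
  remaining digits are zero.\<close>

type_synonym add_state = "int \<times> int \<times> bool \<times> bool \<times> bool \<times> bool"

definition digit_step :: "bool \<Rightarrow> bool \<Rightarrow> int \<Rightarrow> int \<Rightarrow> bool" where
  "digit_step f f' a x \<longleftrightarrow> (x < a \<or> x = a \<and> f) \<and> (f' \<longleftrightarrow> x = 0)"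

text \<open>Terms depending on the digits are collected on the left of the carry equation, so that
  for fixed states it is linear in the digits with a constant right-hand side. The flag
  \<open>e\<close>, once set, persists.\<close>

definition add_step :: "add_state \<Rightarrow> add_state \<Rightarrow> int \<Rightarrow> int \<Rightarrow> int \<Rightarrow> int \<Rightarrow> bool" where
  "add_step = (\<lambda>(A0, A1, f, g, h, e) (A1', A2, f', g', h', e') a x y z.
     0 < a \<and> digit_step f f' a x \<and> digit_step g g' a y \<and> digit_step h h' a z \<and>
     A1' = A1 \<and> A1 * a + (x + y - z) = A0 - A2 \<and> (e \<longrightarrow> x = 0 \<and> y = 0 \<and> z = 0 \<and> e'))"

definition add_states :: "add_state set" where
  "add_states = {-8..8} \<times> {-8..8} \<times> UNIV"

definition add_initial :: "add_state set" where
  "add_initial = {(A0, A1, f, g, h, e). A0 = 0 \<and> \<not> f \<and> \<not> g \<and> \<not> h}"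

definition add_final :: "add_state set" where
  "add_final = {(A0, A1, f, g, h, e). A0 = 0 \<and> A1 = 0 \<and> e}"

text \<open>The flag records that the preceding digit is zero. Its start value \<open>False\<close>
  gives the strict bound on the first digit.\<close>

lemma ostrowski_digits_iff_digit_step:
  assumes "\<And>n. 0 \<le> x n"
  shows "ostrowski_digits a x \<longleftrightarrow> (\<exists>f. \<not> f 0 \<and> (\<forall>n. digit_step (f n) (f (Suc n)) (a n) (x n)))"
proof
  assume L: "ostrowski_digits a x"
  define f where "f n = (case n of 0 \<Rightarrow> False | Suc m \<Rightarrow> x m = 0)" for n
  have "x n < a n \<or> x n = a n \<and> f n" for n
    using L by (cases n) (auto simp: ostrowski_digits_def f_def order_less_le)
  then have "\<not> f 0 \<and> (\<forall>n. digit_step (f n) (f (Suc n)) (a n) (x n))"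
    by (auto simp: digit_step_def f_def)
  then show "\<exists>f. \<not> f 0 \<and> (\<forall>n. digit_step (f n) (f (Suc n)) (a n) (x n))"
    by blast
next
  assume "\<exists>f. \<not> f 0 \<and> (\<forall>n. digit_step (f n) (f (Suc n)) (a n) (x n))"
  then obtain f where f: "\<not> f 0" "\<And>n. digit_step (f n) (f (Suc n)) (a n) (x n)"
    by blast
  have "x 0 < a 0"
    using f(1) f(2)[of 0] by (auto simp: digit_step_def)
  moreover have "x n \<le> a n" for n
    using f(2)[of n] by (auto simp: digit_step_def)
  moreover have "x n = 0" if "x (Suc n) = a (Suc n)" for n
    using f(2)[of n] f(2)[of "Suc n"] that by (auto simp: digit_step_def)
  ultimately show "ostrowski_digits a x"
    using assms by (auto simp: ostrowski_digits_def)
qed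

text \<open>With \<open>e\<close> set and two zero carries, the recursion keeps all later digits and
  carries zero, so a visit to \<open>add_final\<close> supplies the cutoff. Conversely,
  \<open>e\<close> is raised at \<open>N\<close>, from which on every state is final.\<close>

lemma add_run_iff:
  assumes nonneg: "\<And>n. 0 \<le> x n" "\<And>n. 0 \<le> y n" "\<And>n. 0 \<le> z n"
  shows "(\<exists>p. range p \<subseteq> add_states \<and> p 0 \<in> add_initial \<and>
      (\<forall>n. add_step (p n) (p (Suc n)) (a n) (x n) (y n) (z n)) \<and> (\<exists>\<^sub>\<infinity>n. p n \<in> add_final)) \<longleftrightarrow>
    (\<forall>n. a n \<ge> 1) \<and> ostrowski_digits a x \<and> ostrowski_digits a y \<and> ostrowski_digits a z \<and>
    (\<exists>N A. (\<forall>n\<ge>N. x n = 0 \<and> y n = 0 \<and> z n = 0 \<and> A n = 0) \<and> A 0 = 0 \<and> (\<forall>k. \<bar>A k\<bar> \<le> 8) \<and>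
      (\<forall>k. A k = A (Suc k) * a k + A (Suc (Suc k)) + (x k + y k - z k)))"
    (is "?L \<longleftrightarrow> ?R")
proof
  assume ?L
  then obtain p where p: "\<And>n. p n \<in> add_states" "p 0 \<in> add_initial"
      "\<And>n. add_step (p n) (p (Suc n)) (a n) (x n) (y n) (z n)" "\<exists>\<^sub>\<infinity>n. p n \<in> add_final"
    by blast
  define A where "A n = fst (p n)" for n
  define f where "f n = fst (snd (snd (p n)))" for n
  define g where "g n = fst (snd (snd (snd (p n))))" for n
  define h where "h n = fst (snd (snd (snd (snd (p n)))))" for n
  define e where "e n = snd (snd (snd (snd (snd (p n)))))" for n
  \<comment> \<open>The second carry of a state is the first carry of the next one, so the run
    encodes one sequence \<open>A\<close>.\<close>
  have A1: "fst (snd (p n)) = A (Suc n)" for n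
    using p(3)[of n] by (auto simp: add_step_def A_def split: prod.splits)
  have pn: "p n = (A n, A (Suc n), f n, g n, h n, e n)" for n
    using A1[of n] by (simp add: prod_eq_iff A_def f_def g_def h_def e_def)
  note step = p(3)[unfolded pn add_step_def split]
  have od: "ostrowski_digits a x" "ostrowski_digits a y" "ostrowski_digits a z"
    using step p(2) nonneg unfolding pn ostrowski_digits_iff_digit_step[of x, OF nonneg(1)]
      ostrowski_digits_iff_digit_step[of y, OF nonneg(2)]
      ostrowski_digits_iff_digit_step[of z, OF nonneg(3)]
    by (auto simp: add_initial_def)
  obtain N where "p N \<in> add_final"
    using p(4) by (auto simp: INFM_nat)
  then have eN: "e N" "A N = 0" "A (Suc N) = 0"
    unfolding pn by (auto simp: add_final_def)
  have rec: "A k = A (Suc k) * a k + A (Suc (Suc k)) + (x k + y k - z k)" for k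
  proof -
    have "A (Suc k) * a k + (x k + y k - z k) = A k - A (Suc (Suc k))"
      using step[of k] by blast
    then show ?thesis by linarith
  qed
  have late: "e n \<and> A n = 0 \<and> A (Suc n) = 0" if "n \<ge> N" for n
    using that
  proof (induction n rule: dec_induct)
    case (step n)
    then have "x n = 0 \<and> y n = 0 \<and> z n = 0 \<and> e (Suc n)"
      using p(3)[of n, unfolded pn add_step_def split] by blast
    moreover have "A (Suc (Suc n)) = A n - A (Suc n) * a n - (x n + y n - z n)"
      using rec[of n] by linarith
    ultimately show ?case
      using step.IH by simp
  qed (use eN in blast)
  have tail: "\<forall>n\<ge>N. x n = 0 \<and> y n = 0 \<and> z n = 0 \<and> A n = 0"
    using step late by blast
  have "\<bar>A k\<bar> \<le> 8" for k
    using p(1)[of k] unfolding pn by (auto simp: add_states_def)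
  moreover have "A 0 = 0"
    using p(2) unfolding pn by (simp add: add_initial_def)
  moreover have "a n \<ge> 1" for n
    using step[of n] by linarith
  ultimately show ?R
    using od tail rec by blast
next
  assume R: ?R
  then obtain N A where N: "\<forall>n\<ge>N. x n = 0 \<and> y n = 0 \<and> z n = 0 \<and> A n = 0"
    and A: "A 0 = 0" "\<forall>k. \<bar>A k\<bar> \<le> 8"
      "\<forall>k. A k = A (Suc k) * a k + A (Suc (Suc k)) + (x k + y k - z k)"
    by blast
  obtain f where f: "\<not> f 0" "\<And>n. digit_step (f n) (f (Suc n)) (a n) (x n)"
    using R ostrowski_digits_iff_digit_step[of x a, OF nonneg(1)] by blast
  obtain g where g: "\<not> g 0" "\<And>n. digit_step (g n) (g (Suc n)) (a n) (y n)"
    using R ostrowski_digits_iff_digit_step[of y a, OF nonneg(2)] by blast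
  obtain h where h: "\<not> h 0" "\<And>n. digit_step (h n) (h (Suc n)) (a n) (z n)"
    using R ostrowski_digits_iff_digit_step[of z a, OF nonneg(3)] by blast
  define p where "p n = (A n, A (Suc n), f n, g n, h n, n \<ge> N)" for n
  have "p n \<in> add_states" for n
    using A(2)[rule_format, of n] A(2)[rule_format, of "Suc n"] by (auto simp: p_def add_states_def)
  moreover have "p 0 \<in> add_initial"
    using A(1) f(1) g(1) h(1) by (simp add: p_def add_initial_def)
  moreover have "add_step (p n) (p (Suc n)) (a n) (x n) (y n) (z n)" for n
  proof -
    have "a n \<ge> 1" using R by blast
    moreover have "A (Suc n) * a n + (x n + y n - z n) = A n - A (Suc (Suc n))"
      using A(3)[rule_format, of n] by linarith
    ultimately show ?thesis
      unfolding p_def add_step_def split using f(2)[of n] g(2)[of n] h(2)[of n] N by auto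
  qed
  moreover have "\<exists>\<^sub>\<infinity>n. p n \<in> add_final"
    unfolding INFM_nat_le
  proof
    fix m
    have "p (max m N) \<in> add_final"
      using N by (simp add: p_def add_final_def)
    then show "\<exists>n\<ge>m. p n \<in> add_final"
      by (meson max.cobounded1)
  qed
  ultimately show ?L
    by blast
qed

section \<open>The block condition on four parallel tracks\<close>

definition bit1 :: "letter \<times> letter \<times> letter \<times> letter \<Rightarrow> int" where
  "bit1 = (\<lambda>(v, x, y, z). int (bit_value v))"
definition bit2 :: "letter \<times> letter \<times> letter \<times> letter \<Rightarrow> int" where
  "bit2 = (\<lambda>(v, x, y, z). int (bit_value x))"
definition bit3 :: "letter \<times> letter \<times> letter \<times> letter \<Rightarrow> int" where
  "bit3 = (\<lambda>(v, x, y, z). int (bit_value y))"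
definition bit4 :: "letter \<times> letter \<times> letter \<times> letter \<Rightarrow> int" where
  "bit4 = (\<lambda>(v, x, y, z). int (bit_value z))"

definition add_block :: "add_state \<Rightarrow> add_state \<Rightarrow> (letter \<times> letter \<times> letter \<times> letter) list \<Rightarrow> bool" where
  "add_block p p' b \<longleftrightarrow> set b \<subseteq> {Zero, One} \<times> {Zero, One} \<times> {Zero, One} \<times> {Zero, One} \<and>
     add_step p p' (weight_value bit1 b) (weight_value bit2 b) (weight_value bit3 b) (weight_value bit4 b)"

lemma regular_pred_digit_step:
  fixes s t :: "'a::finite \<Rightarrow> int"
  shows "regular_pred (\<lambda>b. digit_step f f' (weight_value s b) (weight_value t b))"
proof -
  have eq: "weight_value t b = weight_value s b \<longleftrightarrow> weight_value (\<lambda>l. t l - s l) b = 0" for b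
    by (simp add: weight_value_diff)
  show ?thesis
    unfolding digit_step_def eq
    by (intro regular_pred_conj regular_pred_disj regular_pred_iff regular_pred_const
        regular_pred_weight_less regular_pred_weight_eq)
qed

text \<open>The product of a carry and a partial quotient does no harm: \<open>A1\<close> is a
  constant once the states are fixed, so all numerical conditions are Boolean combinations of linear
  constraints.\<close>

lemma regular_pred_add_block: "regular_pred (add_block p p')"
proof -
  obtain A0 A1 f g h e where p: "p = (A0, A1, f, g, h, e)"
    by (cases p) auto
  obtain A1' A2 f' g' h' e' where p': "p' = (A1', A2, f', g', h', e')"
    by (cases p') auto
  have pos: "0 < weight_value bit1 b \<longleftrightarrow> weight_value (\<lambda>l. - bit1 l) b \<le> - 1" for b
    by (auto simp: weight_value_uminus)
  have lin: "A1 * weight_value bit1 b + (weight_value bit2 b + weight_value bit3 b - weight_value bit4 b) =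
      weight_value (\<lambda>l. A1 * bit1 l + (bit2 l + bit3 l - bit4 l)) b" for b
    by (simp add: weight_value_add weight_value_diff weight_value_cmult)
  have "regular_pred (\<lambda>b. add_block p p' b)"
    unfolding add_block_def add_step_def p p' split pos lin
    by (intro regular_pred_conj regular_pred_imp regular_pred_const regular_pred_letters
        regular_pred_digit_step regular_pred_weight_eq regular_pred_weight_le)
  then show ?thesis .
qed

lemma subsequence_convolution4:
  "set (subsequence (convolution4 (v, x, y, z)) i j) \<subseteq> B1 \<times> B2 \<times> B3 \<times> B4 \<longleftrightarrow>
    set (subsequence v i j) \<subseteq> B1 \<and> set (subsequence x i j) \<subseteq> B2 \<and>
    set (subsequence y i j) \<subseteq> B3 \<and> set (subsequence z i j) \<subseteq> B4"
  by (auto simp: convolution4_def)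

lemma weight_value_convolution4:
  "weight_value bit1 (subsequence (convolution4 (v, x, y, z)) i j) = int (bin_value (subsequence v i j))"
  "weight_value bit2 (subsequence (convolution4 (v, x, y, z)) i j) = int (bin_value (subsequence x i j))"
  "weight_value bit3 (subsequence (convolution4 (v, x, y, z)) i j) = int (bin_value (subsequence y i j))"
  "weight_value bit4 (subsequence (convolution4 (v, x, y, z)) i j) = int (bin_value (subsequence z i j))"
  unfolding bit1_def bit2_def bit3_def bit4_def case_prod_beta weight_value_bit
  by (simp_all add: subsequence_def convolution4_def comp_def)

text \<open>The leading quadruple of \<open>#\<close> and the restriction to bits in the rest force
  the same cuts on all four words.\<close>

lemma add_blocks_iff:
  assumes h: "h 0 = 0" "strict_mono h"
  shows "(\<forall>n. \<exists>b. subsequence (convolution4 (v, x, y, z)) (h n) (h (Suc n)) = (Hash, Hash, Hash, Hash) # b \<and>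
      add_block (p n) (p (Suc n)) b) \<longleftrightarrow>
    hash_cut h v \<and> hash_cut h x \<and> hash_cut h y \<and> hash_cut h z \<and>
    (\<forall>n. add_step (p n) (p (Suc n)) (digits v n) (digits x n) (digits y n) (digits z n))"
proof -
  let ?w = "convolution4 (v, x, y, z)"
  let ?B = "\<lambda>w n. subsequence w (Suc (h n)) (h (Suc n))"
  have cons: "subsequence ?w (h n) (h (Suc n)) = ?w (h n) # ?B ?w n" for n
    using h(2) by (simp add: subsequence_Cons strict_mono_Suc_iff)
  have uncons: "(\<exists>b. c # c' = d # b \<and> Q b) \<longleftrightarrow> c = d \<and> Q c'" for c d :: 'b and c' Q
    by blast
  have head: "?w i = (Hash, Hash, Hash, Hash) \<longleftrightarrow> v i = Hash \<and> x i = Hash \<and> y i = Hash \<and> z i = Hash" for i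
    by (simp add: convolution4_def)
  have "(\<forall>n. \<exists>b. subsequence ?w (h n) (h (Suc n)) = (Hash, Hash, Hash, Hash) # b \<and>
      add_block (p n) (p (Suc n)) b) \<longleftrightarrow>
    (hash_cut h v \<and> hash_cut h x \<and> hash_cut h y \<and> hash_cut h z) \<and>
    (\<forall>n. add_step (p n) (p (Suc n)) (int (bin_value (?B v n))) (int (bin_value (?B x n)))
      (int (bin_value (?B y n))) (int (bin_value (?B z n))))"
    unfolding cons uncons head add_block_def subsequence_convolution4
      weight_value_convolution4 hash_cut_iff[OF h]
    by blast
  then show ?thesis
    by (auto simp: digits_def block_value_def block_hash_cut)
qed

theorem theorem4p1:
  shows "omega_regular (convolution4 ` oplus_fin)"
proof -
  let ?H = "(Hash, Hash, Hash, Hash)"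
  define L where "L = {w. \<exists>h p. h 0 = 0 \<and> strict_mono h \<and> range p \<subseteq> add_states \<and> p 0 \<in> add_initial \<and>
    (\<forall>n. \<exists>b. subsequence w (h n) (h (Suc n)) = ?H # b \<and> add_block (p n) (p (Suc n)) b) \<and>
    (\<exists>\<^sub>\<infinity>n. p n \<in> add_final)}"
  have "finite add_states"
    by (simp add: add_states_def)
  then have "omega_regular L"
    unfolding L_def by (rule omega_regular_factorization) (intro regular_pred_Cons regular_pred_add_block)
  moreover have mem: "convolution4 (v, x, y, z) \<in> L \<longleftrightarrow> (v, x, y, z) \<in> oplus_fin" for v x y z
  proof -
    have nonneg: "0 \<le> digits w n" for w n
      by (simp add: digits_def)
    have "convolution4 (v, x, y, z) \<in> L \<longleftrightarrow>
      (\<exists>h p. (hash_cut h v \<and> hash_cut h x \<and> hash_cut h y \<and> hash_cut h z) \<and>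
        range p \<subseteq> add_states \<and> p 0 \<in> add_initial \<and>
        (\<forall>n. add_step (p n) (p (Suc n)) (digits v n) (digits x n) (digits y n) (digits z n)) \<and>
        (\<exists>\<^sub>\<infinity>n. p n \<in> add_final))"
      unfolding L_def mem_Collect_eq
    proof (intro iff_exI)
      fix h p
      have "hash_cut h v \<Longrightarrow> h 0 = 0 \<and> strict_mono h"
        by (simp add: hash_cut_def)
      then show "(h 0 = 0 \<and> strict_mono h \<and> range p \<subseteq> add_states \<and> p 0 \<in> add_initial \<and>
          (\<forall>n. \<exists>b. subsequence (convolution4 (v, x, y, z)) (h n) (h (Suc n)) = ?H # b \<and>
            add_block (p n) (p (Suc n)) b) \<and> (\<exists>\<^sub>\<infinity>n. p n \<in> add_final)) \<longleftrightarrow>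
        ((hash_cut h v \<and> hash_cut h x \<and> hash_cut h y \<and> hash_cut h z) \<and>
          range p \<subseteq> add_states \<and> p 0 \<in> add_initial \<and>
          (\<forall>n. add_step (p n) (p (Suc n)) (digits v n) (digits x n) (digits y n) (digits z n)) \<and>
          (\<exists>\<^sub>\<infinity>n. p n \<in> add_final))"
        using add_blocks_iff[of h v x y z p] by argo
    qed
    also have "\<dots> \<longleftrightarrow> (v, x, y, z) \<in> oplus_fin"
      unfolding oplus_fin_iff add_run_iff[OF nonneg nonneg nonneg, symmetric] by blast
    finally show ?thesis .
  qed
  have "L = convolution4 ` oplus_fin"
  proof (intro equalityI subsetI)
    fix w
    assume "w \<in> L"
    \<comment> \<open>Every word over quadruples is the convolution of its four projections, so
      \<open>mem\<close> covers all of \<open>L\<close>.\<close>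
    moreover have "w = convolution4 (\<lambda>i. fst (w i), \<lambda>i. fst (snd (w i)),
        \<lambda>i. fst (snd (snd (w i))), \<lambda>i. snd (snd (snd (w i))))"
      by (simp add: convolution4_def)
    ultimately show "w \<in> convolution4 ` oplus_fin"
      using mem by (metis imageI)
  next
    fix w
    assume "w \<in> convolution4 ` oplus_fin"
    then show "w \<in> L"
      using mem by auto
  qed
  ultimately show ?thesis
    by simp
qed

end
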